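(* The interpolation problem $$\min_{y\in\mathcal{I}_N}\ \tfrac12\|y\|_{\mathbb{Y}}^2 \qquad (\mathrm{I})$$ is equivalent to the maximum a posteriori problem $$\min_{x(t_0),\dots,x(t_N)\in\mathbb{R}^{d(\nu+1)}}\ \mathcal{V}(x(t_{0:N}))\quad\text{subject to}\quad \mathrm{E}_0^\top x(t_0)=y_0,\ \ \mathrm{E}_1^\top x(t_0)=f(t_0,y_0),\ \ \mathrm{E}_1^\top x(t_n)-f(t_n,\mathrm{E}_0^\top x(t_n))=0,\ n=1,\dots,N, \qquad (\mathrm{II})$$ that is: if $\hat y$ solves (I), then the vectors $x(t_n)$ with $\mathrm{E}_m^\top x(t_n)=D^m\hat y(t_n)$, $0\le m\le\nu$, $0\le n\le N$, solve (II); and conversely, if $x(t_{0:N})$ solves (II), then the element $y\in\mathbb{Y}$ of minimal $\mathbb{Y}$-norm among those satisfying $D^my(t_n)=\mathrm{E}_m^\top x(t_n)$, $0\le m\le\nu$, $0\le n\le N$, solves (I).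
   Context: Let $0<T<\infty$, $\mathbb{T}=[0,T]$, $f:\mathbb{T}\times\mathbb{R}^d\to\mathbb{R}^d$, $y_0\in\mathbb{R}^d$, $\nu\ge1$ an integer, and let $\mathbb{T}_N=\{t_n\}_{n=0}^N$ with $0=t_0<t_1<\dots<t_N=T$ and $h_n=t_n-t_{n-1}$. Let $D$ denote the time derivative. Fix $F_m\in\mathbb{R}^{d\times d}$ ($0\le m\le\nu$), a positive definite $\Gamma\in\mathbb{R}^{d\times d}$ and a positive definite $\Sigma(t_0^-)\in\mathbb{R}^{d(\nu+1)\times d(\nu+1)}$. Let $\mathrm{e}_0,\dots,\mathrm{e}_\nu$ be the canonical basis of $\mathbb{R}^{\nu+1}$ and $\mathrm{E}_m=\mathrm{e}_m\otimes\mathrm{I}_d$, so $\mathrm{E}_m^\top x$ is the $m$th $d$-dimensional subvector of $x\in\mathbb{R}^{d(\nu+1)}$. Let $F\in\mathbb{R}^{d(\nu+1)\times d(\nu+1)}$ be the matrix whose nonzero $d\times d$ blocks are $F_{i,i+1}=\mathrm{I}_d$ for $0\le i<\nu$ and $F_{\nu,j}=F_j$ for $0\le j\le\nu$. Set $$A(h)=\exp(Fh),\qquad Q(h)=\int_0^h\exp(F(h-\tau))\,\mathrm{E}_\nu\Gamma\mathrm{E}_\nu^\top\exp(F^\top(h-\tau))\,d\tau .$$ These are the transition parameters of the Gauss--Markov prior $dX=FX\,dt+\mathrm{E}_\nu\Gamma^{1/2}dW$, $X(0)\sim\mathcal{N}(0,\Sigma(t_0^-))$, i.e. $X(t+h)\mid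 X(t)\sim\mathcal{N}(A(h)X(t),Q(h))$. The objective, the negative log-density of $(X(t_0),\dots,X(t_N))$ up to a constant, is $$\mathcal{V}(x(t_{0:N}))=\tfrac12\|x(t_0)\|_{\Sigma(t_0^-)}^2+\tfrac12\sum_{n=1}^N\|x(t_n)-A(h_n)x(t_{n-1})\|_{Q(h_n)}^2,\qquad \|a\|_\Sigma^2=a^\top\Sigma^{-1}a.$$ The space $\mathbb{Y}$ (the RKHS of the prior process $Y=\mathrm{E}_0^\top X$) is the set of $y:\mathbb{T}\to\mathbb{R}^d$ such that $D^my$ is absolutely continuous for $m=0,\dots,\nu$ and $D^{\nu+1}y\in\mathcal{L}_2(\mathbb{T},\mathbb{R}^d)$, with inner product $$\langle y,y'\rangle_{\mathbb{Y}}=\vec y_0^{\,\top}\Sigma(t_0^-)^{-1}\vec y_0^{\,\prime}+\int_0^T(\mathcal{A}y)(\tau)^\top(\mathcal{A}y')(\tau)\,d\tau,\qquad \mathcal{A}=\Gamma^{-1/2}\Big(\mathrm{I}_dD^{\nu+1}-\sum_{m=0}^\nu F_mD^m\Big),$$ where $\vec y_0$ stacks $y(0),Dy(0),\dots,D^\nu y(0)$ (likewise $\vec y_0^{\,\prime}$ for $y'$). With $\mathcal{Z}[y](t)=Dy(t)-f(t,y(t))$, the feasible set is $$\mathcal{I}_N=\{y\in\mathbb{Y}:y(0)=y_0,\ \dot y(0)=f(0,y_0)\}\cap\{y\in\mathbb{Y}:\mathcal{Z}[y](t)=0,\ t\in\mathbb{T}_N\}.$$ *)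

theory Defs
  imports "HOL-Analysis.Analysis"
begin

section \<open>Matrices\<close>

definition pos_def_matrix :: "real^'n^'n \<Rightarrow> bool" where
  "pos_def_matrix A \<longleftrightarrow> transpose A = A \<and> (\<forall>x. x \<noteq> 0 \<longrightarrow> 0 < x \<bullet> (A *v x))"

text \<open>The principal square root; meaningful for positive definite arguments only.\<close>
definition matrix_sqrt :: "real^'n^'n \<Rightarrow> real^'n^'n" where
  "matrix_sqrt A = (THE S. pos_def_matrix S \<and> S ** S = A)"

definition matrix_exp :: "real^'n^'n \<Rightarrow> real^'n^'n" where
  "matrix_exp A = (\<Sum>k. (((**) A) ^^ k) (mat 1) /\<^sub>R fact k)"

definition sq_norm_wrt :: "real^'n^'n \<Rightarrow> real^'n \<Rightarrow> real" where
  "sq_norm_wrt S a = a \<bullet> (matrix_inv S *v a)"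

section \<open>Block structure of the state space\<close>

text \<open>A vector consisting of \<open>\<nu> + 1\<close> blocks of size \<open>CARD('d)\<close> has type \<open>real^('k \<times> 'd)\<close>, where
  \<open>CARD('k) = \<nu> + 1\<close> and the elements of \<open>'k\<close> are numbered \<open>0, \<dots>, \<nu>\<close> in increasing order.\<close>
definition block :: "nat \<Rightarrow> 'k::{finite,linorder}" where
  "block m = sorted_list_of_set (UNIV :: 'k set) ! m"

text \<open>The Kronecker product of the canonical basis vector \<open>axis (block m) 1\<close> with the identity
  matrix.\<close>
definition E :: "nat \<Rightarrow> real^'d^('k::{finite,linorder} \<times> 'd)" where
  "E m = (\<chi> p b. axis (block m) 1 $ fst p * mat 1 $ snd p $ b)"

text \<open>\<open>E i ** B ** transpose (E j)\<close> is the matrix with block \<open>B\<close> at position \<open>(i, j)\<close> and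
  all other blocks zero.\<close>
definition drift :: "nat \<Rightarrow> (nat \<Rightarrow> real^'d^'d) \<Rightarrow>
    real^('k::{finite,linorder} \<times> 'd)^('k \<times> 'd)" where
  "drift \<nu> F = (\<Sum>i<\<nu>. E i ** mat 1 ** transpose (E (Suc i)))
             + (\<Sum>j\<le>\<nu>. E \<nu> ** F j ** transpose (E j))"

definition transition_matrix :: "nat \<Rightarrow> (nat \<Rightarrow> real^'d^'d) \<Rightarrow> real \<Rightarrow>
    real^('k::{finite,linorder} \<times> 'd)^('k \<times> 'd)" where
  "transition_matrix \<nu> F h = matrix_exp (h *\<^sub>R drift \<nu> F)"

definition transition_cov :: "nat \<Rightarrow> (nat \<Rightarrow> real^'d^'d) \<Rightarrow> real^'d^'d \<Rightarrow> real \<Rightarrow>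
    real^('k::{finite,linorder} \<times> 'd)^('k \<times> 'd)" where
  "transition_cov \<nu> F \<Gamma> h = (LINT \<tau>:{0..h}|lebesgue.
     matrix_exp ((h - \<tau>) *\<^sub>R drift \<nu> F) ** E \<nu> ** \<Gamma> ** transpose (E \<nu>)
       ** matrix_exp ((h - \<tau>) *\<^sub>R transpose (drift \<nu> F)))"

section \<open>The maximum a posteriori problem\<close>

text \<open>The vector \<open>x n\<close> is the state at the grid point \<open>t n\<close>; only \<open>n \<le> N\<close> is relevant.\<close>
definition map_objective :: "nat \<Rightarrow> (nat \<Rightarrow> real^'d^'d) \<Rightarrow> real^'d^'d \<Rightarrow>
    real^('k::{finite,linorder} \<times> 'd)^('k \<times> 'd) \<Rightarrow> nat \<Rightarrow> (nat \<Rightarrow> real) \<Rightarrow>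
    (nat \<Rightarrow> real^('k \<times> 'd)) \<Rightarrow> real" where
  "map_objective \<nu> F \<Gamma> \<Sigma>0 N t x =
     1/2 * sq_norm_wrt \<Sigma>0 (x 0)
   + 1/2 * (\<Sum>n=1..N. sq_norm_wrt (transition_cov \<nu> F \<Gamma> (t n - t (n - 1)))
              (x n - transition_matrix \<nu> F (t n - t (n - 1)) *v x (n - 1)))"

definition map_feasible :: "(real \<Rightarrow> real^'d \<Rightarrow> real^'d) \<Rightarrow> real^'d \<Rightarrow> nat \<Rightarrow> (nat \<Rightarrow> real) \<Rightarrow>
    (nat \<Rightarrow> real^('k::{finite,linorder} \<times> 'd)) \<Rightarrow> bool" where
  "map_feasible f y0 N t x \<longleftrightarrow>
     transpose (E 0) *v x 0 = y0 \<and>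
     transpose (E 1) *v x 0 = f (t 0) y0 \<and>
     (\<forall>n\<in>{1..N}. transpose (E 1) *v x n - f (t n) (transpose (E 0) *v x n) = 0)"

section \<open>The function space\<close>

text \<open>The derivatives on \<open>{0..T}\<close>, one-sided at the end points; arbitrary values where the
  derivative does not exist.\<close>
primrec D :: "real \<Rightarrow> nat \<Rightarrow> (real \<Rightarrow> real^'d) \<Rightarrow> real \<Rightarrow> real^'d" where
  "D T 0 y = y"
| "D T (Suc m) y = (\<lambda>t. vector_derivative (D T m y) (at t within {0..T}))"

definition abs_continuous_on_interval :: "real \<Rightarrow> real \<Rightarrow> (real \<Rightarrow> 'a::real_normed_vector) \<Rightarrow> bool"
  where
  "abs_continuous_on_interval a b g \<longleftrightarrow>
     (\<forall>\<epsilon>>0. \<exists>\<delta>>0. \<forall>n. \<forall>u v :: nat \<Rightarrow> real.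
        (\<forall>i<n. a \<le> u i \<and> u i \<le> v i \<and> v i \<le> b) \<longrightarrow>
        disjoint_family_on (\<lambda>i. {u i<..<v i}) {..<n} \<longrightarrow>
        (\<Sum>i<n. v i - u i) < \<delta> \<longrightarrow>
        (\<Sum>i<n. norm (g (v i) - g (u i))) < \<epsilon>)"

definition square_integrable_on_interval :: "real \<Rightarrow> real \<Rightarrow> (real \<Rightarrow> real^'d) \<Rightarrow> bool" where
  "square_integrable_on_interval a b g \<longleftrightarrow>
     set_borel_measurable lebesgue {a..b} g \<and>
     set_integrable lebesgue {a..b} (\<lambda>t. (norm (g t))\<^sup>2)"

text \<open>Functions with domain \<open>{0..T}\<close> are represented by total functions that are \<^const>\<open>undefined\<close>
  elsewhere, so that two elements are equal iff they agree on \<open>{0..T}\<close>. The derivatives of order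
  up to \<open>\<nu>\<close> exist everywhere. The existence of the derivative of order \<open>\<nu> + 1\<close> almost everywhere
  follows from absolute continuity; it is spelled out because \<^const>\<open>D\<close> is total.\<close>
definition Y_space :: "nat \<Rightarrow> real \<Rightarrow> (real \<Rightarrow> real^'d) set" where
  "Y_space \<nu> T = {y \<in> extensional {0..T}.
     (\<forall>m<\<nu>. \<forall>t\<in>{0..T}. D T m y differentiable (at t within {0..T})) \<and>
     (\<forall>m\<le>\<nu>. abs_continuous_on_interval 0 T (D T m y)) \<and>
     (AE t in lebesgue. t \<in> {0..T} \<longrightarrow> D T \<nu> y differentiable (at t within {0..T})) \<and>
     square_integrable_on_interval 0 T (D T (Suc \<nu>) y)}"

definition A_op :: "nat \<Rightarrow> real \<Rightarrow> (nat \<Rightarrow> real^'d^'d) \<Rightarrow> real^'d^'d \<Rightarrow>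
    (real \<Rightarrow> real^'d) \<Rightarrow> real \<Rightarrow> real^'d" where
  "A_op \<nu> T F \<Gamma> y t =
     matrix_inv (matrix_sqrt \<Gamma>) *v (D T (Suc \<nu>) y t - (\<Sum>m\<le>\<nu>. F m *v D T m y t))"

text \<open>The stacked derivatives \<open>y t, D y t, \<dots>, D\<^sup>\<nu> y t\<close>.\<close>
definition stacked :: "nat \<Rightarrow> real \<Rightarrow> (real \<Rightarrow> real^'d) \<Rightarrow> real \<Rightarrow>
    real^('k::{finite,linorder} \<times> 'd)" where
  "stacked \<nu> T y t = (\<Sum>m\<le>\<nu>. E m *v D T m y t)"

definition Y_inner :: "nat \<Rightarrow> real \<Rightarrow> (nat \<Rightarrow> real^'d^'d) \<Rightarrow> real^'d^'d \<Rightarrow>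
    real^('k::{finite,linorder} \<times> 'd)^('k \<times> 'd) \<Rightarrow>
    (real \<Rightarrow> real^'d) \<Rightarrow> (real \<Rightarrow> real^'d) \<Rightarrow> real" where
  "Y_inner \<nu> T F \<Gamma> \<Sigma>0 y y' =
     stacked \<nu> T y 0 \<bullet> (matrix_inv \<Sigma>0 *v stacked \<nu> T y' 0)
   + (LINT \<tau>:{0..T}|lebesgue. A_op \<nu> T F \<Gamma> y \<tau> \<bullet> A_op \<nu> T F \<Gamma> y' \<tau>)"

definition Y_norm :: "nat \<Rightarrow> real \<Rightarrow> (nat \<Rightarrow> real^'d^'d) \<Rightarrow> real^'d^'d \<Rightarrow>
    real^('k::{finite,linorder} \<times> 'd)^('k \<times> 'd) \<Rightarrow> (real \<Rightarrow> real^'d) \<Rightarrow> real" where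
  "Y_norm \<nu> T F \<Gamma> \<Sigma>0 y = sqrt (Y_inner \<nu> T F \<Gamma> \<Sigma>0 y y)"

section \<open>The interpolation problem\<close>

definition residual :: "real \<Rightarrow> (real \<Rightarrow> real^'d \<Rightarrow> real^'d) \<Rightarrow> (real \<Rightarrow> real^'d) \<Rightarrow>
    real \<Rightarrow> real^'d" where
  "residual T f y t = D T 1 y t - f t (y t)"

definition interp_feasible :: "nat \<Rightarrow> real \<Rightarrow> (real \<Rightarrow> real^'d \<Rightarrow> real^'d) \<Rightarrow> real^'d \<Rightarrow>
    nat \<Rightarrow> (nat \<Rightarrow> real) \<Rightarrow> (real \<Rightarrow> real^'d) set" where
  "interp_feasible \<nu> T f y0 N t =
     {y \<in> Y_space \<nu> T. y 0 = y0 \<and> D T 1 y 0 = f 0 y0} \<inter>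
     {y \<in> Y_space \<nu> T. \<forall>s \<in> t ` {0..N}. residual T f y s = 0}"

definition solves_interp :: "nat \<Rightarrow> real \<Rightarrow> (nat \<Rightarrow> real^'d^'d) \<Rightarrow> real^'d^'d \<Rightarrow>
    real^('k::{finite,linorder} \<times> 'd)^('k \<times> 'd) \<Rightarrow>
    (real \<Rightarrow> real^'d \<Rightarrow> real^'d) \<Rightarrow> real^'d \<Rightarrow> nat \<Rightarrow> (nat \<Rightarrow> real) \<Rightarrow>
    (real \<Rightarrow> real^'d) \<Rightarrow> bool" where
  "solves_interp \<nu> T F \<Gamma> \<Sigma>0 f y0 N t =
     is_arg_min (\<lambda>y. 1/2 * (Y_norm \<nu> T F \<Gamma> \<Sigma>0 y)\<^sup>2) (\<lambda>y. y \<in> interp_feasible \<nu> T f y0 N t)"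

definition solves_map :: "nat \<Rightarrow> (nat \<Rightarrow> real^'d^'d) \<Rightarrow> real^'d^'d \<Rightarrow>
    real^('k::{finite,linorder} \<times> 'd)^('k \<times> 'd) \<Rightarrow>
    (real \<Rightarrow> real^'d \<Rightarrow> real^'d) \<Rightarrow> real^'d \<Rightarrow> nat \<Rightarrow> (nat \<Rightarrow> real) \<Rightarrow>
    (nat \<Rightarrow> real^('k \<times> 'd)) \<Rightarrow> bool" where
  "solves_map \<nu> F \<Gamma> \<Sigma>0 f y0 N t =
     is_arg_min (map_objective \<nu> F \<Gamma> \<Sigma>0 N t) (map_feasible f y0 N t)"

definition states_of :: "nat \<Rightarrow> real \<Rightarrow> nat \<Rightarrow> (nat \<Rightarrow> real) \<Rightarrow> (real \<Rightarrow> real^'d) \<Rightarrow>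
    (nat \<Rightarrow> real^('k::{finite,linorder} \<times> 'd)) \<Rightarrow> bool" where
  "states_of \<nu> T N t y x \<longleftrightarrow> (\<forall>n\<le>N. \<forall>m\<le>\<nu>. transpose (E m) *v x n = D T m y (t n))"

definition min_norm_interpolant :: "nat \<Rightarrow> real \<Rightarrow> (nat \<Rightarrow> real^'d^'d) \<Rightarrow> real^'d^'d \<Rightarrow>
    real^('k::{finite,linorder} \<times> 'd)^('k \<times> 'd) \<Rightarrow> nat \<Rightarrow> (nat \<Rightarrow> real) \<Rightarrow>
    (nat \<Rightarrow> real^('k \<times> 'd)) \<Rightarrow> (real \<Rightarrow> real^'d) \<Rightarrow> bool" where
  "min_norm_interpolant \<nu> T F \<Gamma> \<Sigma>0 N t x =
     is_arg_min (Y_norm \<nu> T F \<Gamma> \<Sigma>0) (\<lambda>y. y \<in> Y_space \<nu> T \<and> states_of \<nu> T N t y x)"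

end

theory Submission
  imports Defs
begin

text \<open>With \<open>z\<close> the stacked derivatives of \<open>y \<in> Y\<close>, the matrix \<open>B = E\<^sub>\<nu> \<Gamma>\<^sup>1\<^sup>/\<^sup>2\<close> and the
  input \<open>u = \<A> y\<close>, the definition of \<open>\<A>\<close> is the linear state equation \<open>z' = F z + B u\<close>.
  Variation of constants turns the residual \<open>r\<^sub>n = z(t\<^sub>n) - A(h\<^sub>n) z(t\<^sub>n\<^sub>-\<^sub>1)\<close> into an integral of \<open>u\<close>,
  and \<open>Q(h\<^sub>n)\<close> is the controllability Gramian of \<open>(F, B)\<close>, so completing the square gives
  \<open>\<integral> |u|\<^sup>2 = r\<^sub>n \<bullet> Q(h\<^sub>n)\<^sup>-\<^sup>1 r\<^sub>n + \<integral> |u - u\<^sup>*|\<^sup>2\<close> on each grid interval, where the minimum energy input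
  \<open>u\<^sup>*\<close> depends on the grid states only. Summation gives
  \<open>1/2 \<parallel>y\<parallel>\<^sup>2 = \<V>(x) + 1/2 \<integral> |u - u\<^sup>*|\<^sup>2\<close> for the grid states \<open>x\<close> of \<open>y\<close>. Steering with \<open>u\<^sup>*\<close>
  realises every \<open>x\<close> with equality, uniquely so, and feasibility depends on the grid states only;
  hence the two problems correspond.\<close>

section \<open>The matrix exponential\<close>

text \<open>\<open>Q(h)\<close> enters through its inverse, so it must be positive definite although
  the noise drives the last block only: the drift is a companion matrix that passes the input on
  from block to block, which is the content of \<open>drift_controllable\<close>. Two mismatches
  shape the rest. First, the derivative of order \<open>\<nu> + 1\<close> exists only almost
  everywhere, so the state equation holds off a null set, and values are recovered from derivatives
  by absolute continuity and a fundamental theorem for the gauge integral. Second, \<open>D\<close>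
  iterates a total derivative operator, while the steered state may have kinks at grid points; that
  its first block has derivatives up to order \<open>\<nu>\<close> everywhere is recovered from the
  integral form of the equation. The root of \<open>\<Gamma>\<close> is a definite description,
  hence the detour through the spectral theorem for existence and uniqueness. No solution of either
  problem is constructed: the initial-value term is the same on both sides, and every competitor is
  carried to the other problem at equal or smaller cost.\<close>

lemma bounded_bilinear_matrix_mult:
  "bounded_bilinear ((**) :: real^'m^'n \<Rightarrow> real^'p^'m \<Rightarrow> real^'p^'n)"
  unfolding bilinear_conv_bounded_bilinear[symmetric] bilinear_def
  by (auto intro!: linearI simp: matrix_matrix_mult_def vec_eq_iff sum.distrib algebra_simps sum_distrib_left)

lemma bounded_bilinear_matrix_vector_mult:
  "bounded_bilinear ((*v) :: real^'m^'n \<Rightarrow> real^'m \<Rightarrow> real^'n)"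
  unfolding bilinear_conv_bounded_bilinear[symmetric] bilinear_def
  by (auto intro!: linearI simp: algebra_simps
      matrix_vector_mult_scaleR scaleR_matrix_vector_assoc)

interpretation matrix_mult: bounded_bilinear
  "(**) :: real^'m^'n \<Rightarrow> real^'p^'m \<Rightarrow> real^'p^'n"
  by (rule bounded_bilinear_matrix_mult)

interpretation matrix_vector_mult: bounded_bilinear
  "(*v) :: real^'m^'n \<Rightarrow> real^'m \<Rightarrow> real^'n"
  by (rule bounded_bilinear_matrix_vector_mult)

lemma bounded_linear_transpose: "bounded_linear (transpose :: real^'m^'n \<Rightarrow> real^'n^'m)"
  unfolding linear_conv_bounded_linear[symmetric]
  by (auto intro!: linearI simp: transpose_def vec_eq_iff)

lemma inner_matrix_vector_mult_left:
  fixes A :: "real^'m^'n"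
  shows "(A *v x) \<bullet> y = x \<bullet> (transpose A *v y)"
  by (metis dot_lmul_matrix transpose_matrix_vector inner_commute)

lemma matrix_power_commute:
  fixes A :: "real^'n^'n"
  shows "A ** ((**) A ^^ k) (mat 1) = ((**) A ^^ k) (mat 1) ** A"
  by (induction k) (simp_all add: matrix_mul_assoc)

lemma matrix_power_scaleR:
  fixes A :: "real^'n^'n"
  shows "((**) (t *\<^sub>R A) ^^ k) (mat 1) = t ^ k *\<^sub>R ((**) A ^^ k) (mat 1)"
  by (induction k) (simp_all add: matrix_mult.scaleR_left matrix_mult.scaleR_right)

lemma transpose_matrix_power:
  fixes A :: "real^'n^'n"
  shows "transpose (((**) A ^^ k) (mat 1)) = ((**) (transpose A) ^^ k) (mat 1)"
  by (induction k) (simp_all add: matrix_transpose_mul matrix_power_commute)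

lemma summable_matrix_exp:
  fixes A :: "real^'n^'n"
  shows "summable (\<lambda>k. ((**) A ^^ k) (mat 1) /\<^sub>R fact k)"
proof -
  \<comment> \<open>The norm is the Euclidean norm of the entries; \<open>K\<close> is the constant
    of bounded bilinearity, so the powers are dominated by a real exponential series in
    \<open>K * norm A\<close>.\<close>
  obtain K where K: "K > 0" "\<And>X Y. norm ((X::real^'n^'n) ** (Y::real^'n^'n)) \<le> norm X * norm Y * K"
    using matrix_mult.pos_bounded by blast
  let ?c = "K * norm A" and ?m = "norm (mat 1 :: real^'n^'n)"
  have bound: "norm (((**) A ^^ k) (mat 1)) \<le> ?c ^ k * ?m" for k
  proof (induction k)
    case (Suc k)
    have "norm (((**) A ^^ Suc k) (mat 1)) \<le> norm A * norm (((**) A ^^ k) (mat 1)) * K"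
      using K(2) by simp
    also have "\<dots> \<le> norm A * (?c ^ k * ?m) * K"
      using K(1) Suc by (intro mult_right_mono mult_left_mono) auto
    finally show ?case by (simp add: algebra_simps)
  qed simp
  have "summable (\<lambda>k. (?c ^ k /\<^sub>R fact k) * ?m)"
    by (intro summable_mult2 summable_exp_generic)
  then show ?thesis
  proof (rule summable_comparison_test'[where N = 0])
    fix k :: nat
    have "inverse (fact k) * norm (((**) A ^^ k) (mat 1)) \<le> inverse (fact k) * (?c ^ k * ?m)"
      by (intro mult_left_mono bound) auto
    then show "norm (((**) A ^^ k) (mat 1) /\<^sub>R fact k) \<le> (?c ^ k /\<^sub>R fact k) * ?m"
      by (simp add: algebra_simps)
  qed
qed

lemma matrix_exp_0: "matrix_exp (0 :: real^'n^'n) = mat 1"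
  unfolding matrix_exp_def
proof (subst suminf_finite[where N = "{0}"])
  fix k :: nat
  assume "k \<notin> {0}"
  then show "((**) 0 ^^ k) (mat 1) /\<^sub>R fact k = (0 :: real^'n^'n)"
    by (cases k) (simp_all add: matrix_mult.zero_left)
qed simp_all

lemma matrix_exp_commute:
  fixes A :: "real^'n^'n"
  shows "A ** matrix_exp (t *\<^sub>R A) = matrix_exp (t *\<^sub>R A) ** A"
proof -
  note summable = summable_matrix_exp[of "t *\<^sub>R A"]
  have "A ** matrix_exp (t *\<^sub>R A) = (\<Sum>k. A ** (((**) (t *\<^sub>R A) ^^ k) (mat 1) /\<^sub>R fact k))"
    unfolding matrix_exp_def by (rule bounded_linear.suminf[OF matrix_mult.bounded_linear_right summable])
  also have "\<dots> = (\<Sum>k. (((**) (t *\<^sub>R A) ^^ k) (mat 1) /\<^sub>R fact k) ** A)"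
    by (simp add: matrix_mult.scaleR_left matrix_mult.scaleR_right matrix_power_scaleR matrix_power_commute)
  also have "\<dots> = matrix_exp (t *\<^sub>R A) ** A"
    unfolding matrix_exp_def by (rule bounded_linear.suminf[OF matrix_mult.bounded_linear_left summable, symmetric])
  finally show ?thesis .
qed

lemma transpose_matrix_exp:
  fixes A :: "real^'n^'n"
  shows "transpose (matrix_exp A) = matrix_exp (transpose A)"
  unfolding matrix_exp_def
  by (simp add: bounded_linear.suminf[OF bounded_linear_transpose summable_matrix_exp]
      linear_cmul[OF bounded_linear.linear[OF bounded_linear_transpose]] transpose_matrix_power)

text \<open>Paired with a fixed matrix \<open>b\<close>, the exponential is a real power series in
  \<open>t\<close> that converges everywhere, so termwise differentiation applies; taking basis
  elements for \<open>b\<close> gives the matrix statement.\<close>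

lemma has_vector_derivative_matrix_exp:
  fixes A :: "real^'n^'n"
  shows "((\<lambda>t. matrix_exp (t *\<^sub>R A)) has_vector_derivative A ** matrix_exp (t *\<^sub>R A)) (at t within S)"
proof -
  have "((\<lambda>t. matrix_exp (t *\<^sub>R A) \<bullet> b) has_real_derivative (A ** matrix_exp (t *\<^sub>R A)) \<bullet> b) (at t)"
    for b
  proof -
    define c where "c k = (((**) A ^^ k) (mat 1) \<bullet> b) / fact k" for k
    have term_eq: "(((**) (s *\<^sub>R A) ^^ k) (mat 1) /\<^sub>R fact k) \<bullet> b = c k * s ^ k" for s k
      by (simp add: c_def matrix_power_scaleR field_simps)
    have sums: "(\<lambda>k. c k * s ^ k) sums (matrix_exp (s *\<^sub>R A) \<bullet> b)" for s
      using bounded_linear.sums[OF bounded_linear_inner_left summable_sums[OF summable_matrix_exp], of "s *\<^sub>R A" b]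
      unfolding term_eq matrix_exp_def .
    have "(\<lambda>k. (A ** (((**) (t *\<^sub>R A) ^^ k) (mat 1) /\<^sub>R fact k)) \<bullet> b) sums ((A ** matrix_exp (t *\<^sub>R A)) \<bullet> b)"
      unfolding matrix_exp_def
      by (intro bounded_linear.sums[OF bounded_linear_inner_left]
          bounded_linear.sums[OF matrix_mult.bounded_linear_right] summable_sums summable_matrix_exp)
    moreover have "(A ** (((**) (t *\<^sub>R A) ^^ k) (mat 1) /\<^sub>R fact k)) \<bullet> b = diffs c k * t ^ k" for k
      by (simp add: diffs_def c_def matrix_power_scaleR matrix_mult.scaleR_right field_simps
          del: of_nat_Suc)
    ultimately have "(\<Sum>k. diffs c k * t ^ k) = (A ** matrix_exp (t *\<^sub>R A)) \<bullet> b"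
      by (simp add: sums_iff)
    moreover have "(\<lambda>s. \<Sum>k. c k * s ^ k) = (\<lambda>s. matrix_exp (s *\<^sub>R A) \<bullet> b)"
      using sums by (auto simp: sums_iff)
    ultimately show ?thesis
      using termdiffs_strong_converges_everywhere[of c t] sums_summable[OF sums] by simp
  qed
  then have "((\<lambda>t. matrix_exp (t *\<^sub>R A)) has_vector_derivative A ** matrix_exp (t *\<^sub>R A)) (at t)"
    unfolding has_vector_derivative_def
    by (subst has_derivative_componentwise_within)
      (simp add: has_field_derivative_def mult_commute_abs)
  then show ?thesis
    by (rule has_vector_derivative_at_within)
qed

lemma has_vector_derivative_matrix_exp_shift:
  fixes A :: "real^'n^'n"
  shows "((\<lambda>t. matrix_exp ((b - t) *\<^sub>R A)) has_vector_derivative - (matrix_exp ((b - t) *\<^sub>R A) ** A))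
    (at t within S)"
proof -
  have "((\<lambda>t. b - t) has_vector_derivative -1) (at t within S)"
    by (auto intro!: derivative_eq_intros)
  from vector_diff_chain_within[OF this has_vector_derivative_matrix_exp, of A]
  show ?thesis
    by (simp add: o_def matrix_exp_commute)
qed

lemma continuous_on_matrix_exp:
  fixes A :: "real^'n^'n"
  shows "continuous_on S (\<lambda>t. matrix_exp (t *\<^sub>R A))" "continuous_on S (\<lambda>t. matrix_exp ((b - t) *\<^sub>R A))"
  by (rule continuous_on_vector_derivative, rule has_vector_derivative_matrix_exp)
    (rule continuous_on_vector_derivative, rule has_vector_derivative_matrix_exp_shift)

text \<open>The product has derivative zero, because \<open>A\<close> commutes with both factors,
  and equals the identity at \<open>0\<close>. Writing the second exponent with \<open>0 - t\<close>
  makes the shifted derivative rule match.\<close>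

lemma matrix_exp_inverse:
  fixes A :: "real^'n^'n"
  shows "matrix_exp (t *\<^sub>R A) ** matrix_exp (- t *\<^sub>R A) = mat 1"
proof -
  let ?g = "\<lambda>t. matrix_exp (t *\<^sub>R A) ** matrix_exp ((0 - t) *\<^sub>R A)"
  have "(?g has_vector_derivative
      matrix_exp (s *\<^sub>R A) ** (- (matrix_exp ((0 - s) *\<^sub>R A) ** A)) + A ** matrix_exp (s *\<^sub>R A) ** matrix_exp ((0 - s) *\<^sub>R A))
      (at s)" for s
    by (intro matrix_mult.has_vector_derivative has_vector_derivative_matrix_exp
        has_vector_derivative_matrix_exp_shift)
  moreover have "matrix_exp (s *\<^sub>R A) ** (- (matrix_exp ((0 - s) *\<^sub>R A) ** A))
      + A ** matrix_exp (s *\<^sub>R A) ** matrix_exp ((0 - s) *\<^sub>R A) = 0" for s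
    using matrix_exp_commute[of A s] matrix_exp_commute[of A "0 - s"]
    by (simp add: matrix_mult.minus_right) (metis matrix_mul_assoc)
  ultimately have "(?g has_vector_derivative 0) (at s within UNIV)" for s by simp
  then obtain c where "\<And>s. ?g s = c"
    using has_vector_derivative_zero_constant[OF convex_UNIV, of ?g] by auto
  from this[of 0] this[of t] show ?thesis
    by (simp add: matrix_exp_0)
qed

section \<open>Absolutely continuous functions\<close>

text \<open>The definition indexes intervals by \<open>{..<n}\<close>. Tagged divisions are finite
  sets of pairs, so the condition is carried to arbitrary finite index sets along an
  enumeration.\<close>

lemma abs_continuousE:
  fixes f :: "real \<Rightarrow> 'a::real_normed_vector"
  assumes "abs_continuous_on_interval a b f" "\<epsilon> > 0"
  obtains \<delta> where "\<delta> > 0"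
    and "\<forall>I u v. finite (I :: 'i set) \<longrightarrow> (\<forall>i\<in>I. a \<le> u i \<and> u i \<le> v i \<and> v i \<le> b) \<longrightarrow>
      disjoint_family_on (\<lambda>i. {u i<..<v i}) I \<longrightarrow> (\<Sum>i\<in>I. v i - u i) < \<delta> \<longrightarrow>
      (\<Sum>i\<in>I. norm (f (v i) - f (u i))) < \<epsilon>"
proof -
  obtain \<delta> where "\<delta> > 0" and \<delta>: "\<forall>n u v. (\<forall>i<n. a \<le> u i \<and> u i \<le> v i \<and> v i \<le> b) \<longrightarrow>
        disjoint_family_on (\<lambda>i. {u i<..<v i}) {..<n::nat} \<longrightarrow>
        (\<Sum>i<n. v i - u i) < \<delta> \<longrightarrow> (\<Sum>i<n. norm (f (v i) - f (u i))) < \<epsilon>"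
    using assms unfolding abs_continuous_on_interval_def by (elim allE[of _ \<epsilon>]) blast
  show thesis
  proof (rule that[OF \<open>\<delta> > 0\<close>], intro allI impI)
    fix I :: "'i set" and u v :: "'i \<Rightarrow> real"
    assume "finite I" and uv: "\<forall>i\<in>I. a \<le> u i \<and> u i \<le> v i \<and> v i \<le> b"
      and disj: "disjoint_family_on (\<lambda>i. {u i<..<v i}) I" and len: "(\<Sum>i\<in>I. v i - u i) < \<delta>"
    obtain g where g: "bij_betw g {..<card I} I"
      using ex_bij_betw_nat_finite[OF \<open>finite I\<close>] by (auto simp: atLeast0LessThan)
    then have inj: "inj_on g {..<card I}" and mem: "\<And>i. i < card I \<Longrightarrow> g i \<in> I"
      by (auto simp: bij_betw_def)
    have "\<forall>i<card I. a \<le> u (g i) \<and> u (g i) \<le> v (g i) \<and> v (g i) \<le> b"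
      using uv mem by blast
    moreover have "disjoint_family_on (\<lambda>i. {u (g i)<..<v (g i)}) {..<card I}"
      unfolding disjoint_family_on_def
    proof (intro ballI impI)
      fix i j
      assume "i \<in> {..<card I}" "j \<in> {..<card I}" "i \<noteq> j"
      then have "g i \<in> I" "g j \<in> I" "g i \<noteq> g j"
        using mem inj_onD[OF inj] by auto
      then show "{u (g i)<..<v (g i)} \<inter> {u (g j)<..<v (g j)} = {}"
        using disj unfolding disjoint_family_on_def by blast
    qed
    moreover have "(\<Sum>i<card I. v (g i) - u (g i)) < \<delta>"
      using len sum.reindex_bij_betw[OF g, of "\<lambda>i. v i - u i"] by simp
    ultimately have "(\<Sum>i<card I. norm (f (v (g i)) - f (u (g i)))) < \<epsilon>"
      using \<delta>[rule_format, of "card I" "\<lambda>i. u (g i)" "\<lambda>i. v (g i)"] by blast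
    then show "(\<Sum>i\<in>I. norm (f (v i) - f (u i))) < \<epsilon>"
      using sum.reindex_bij_betw[OF g, of "\<lambda>i. norm (f (v i) - f (u i))"] by simp
  qed
qed

lemma abs_continuousI:
  fixes f :: "real \<Rightarrow> 'a::real_normed_vector"
  assumes "\<And>\<epsilon>. \<epsilon> > 0 \<Longrightarrow> \<exists>\<delta>>0. \<forall>n u v. (\<forall>i\<in>{..<n}. a \<le> u i \<and> u i \<le> v i \<and> v i \<le> b) \<longrightarrow>
      disjoint_family_on (\<lambda>i. {u i<..<v i}) {..<n::nat} \<longrightarrow> (\<Sum>i<n. v i - u i) < \<delta> \<longrightarrow>
      (\<Sum>i<n. norm (f (v i) - f (u i))) < \<epsilon>"
  shows "abs_continuous_on_interval a b f"
  using assms unfolding abs_continuous_on_interval_def Ball_def lessThan_iff by (intro allI impI)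

text \<open>Common source of the closure properties. Two dominating functions serve sums and
  products; where one suffices it is passed twice. As the bound concerns \<open>[a, b]\<close> only,
  this also transfers absolute continuity between functions that agree there.\<close>

lemma abs_continuous_dominated:
  fixes f :: "real \<Rightarrow> 'a::real_normed_vector" and g :: "real \<Rightarrow> 'b::real_normed_vector"
    and h :: "real \<Rightarrow> 'c::real_normed_vector"
  assumes f: "abs_continuous_on_interval a b f" and g: "abs_continuous_on_interval a b g"
    and le: "\<And>s t. a \<le> s \<Longrightarrow> s \<le> t \<Longrightarrow> t \<le> b \<Longrightarrow>
      norm (h t - h s) \<le> K * (norm (f t - f s) + norm (g t - g s))"
  shows "abs_continuous_on_interval a b h"
proof (rule abs_continuousI)
  fix \<epsilon> :: real
  assume "\<epsilon> > 0"
  \<comment> \<open>\<open>\<bar>K\<bar> + 1\<close> keeps the denominator positive for every real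
    \<open>K\<close> and makes the final inequality strict.\<close>
  define e where "e = \<epsilon> / (2 * (\<bar>K\<bar> + 1))"
  have "e > 0"
    using \<open>\<epsilon> > 0\<close> by (simp add: e_def)
  obtain d1 where "d1 > 0" and d1: "\<forall>I u v. finite (I :: nat set) \<longrightarrow> (\<forall>i\<in>I. a \<le> u i \<and> u i \<le> v i \<and> v i \<le> b) \<longrightarrow>
      disjoint_family_on (\<lambda>i. {u i<..<v i}) I \<longrightarrow> (\<Sum>i\<in>I. v i - u i) < d1 \<longrightarrow>
      (\<Sum>i\<in>I. norm (f (v i) - f (u i))) < e"
    by (rule abs_continuousE[OF f \<open>e > 0\<close>])
  obtain d2 where "d2 > 0" and d2: "\<forall>I u v. finite (I :: nat set) \<longrightarrow> (\<forall>i\<in>I. a \<le> u i \<and> u i \<le> v i \<and> v i \<le> b) \<longrightarrow>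
      disjoint_family_on (\<lambda>i. {u i<..<v i}) I \<longrightarrow> (\<Sum>i\<in>I. v i - u i) < d2 \<longrightarrow>
      (\<Sum>i\<in>I. norm (g (v i) - g (u i))) < e"
    by (rule abs_continuousE[OF g \<open>e > 0\<close>])
  show "\<exists>\<delta>>0. \<forall>n u v. (\<forall>i\<in>{..<n}. a \<le> u i \<and> u i \<le> v i \<and> v i \<le> b) \<longrightarrow>
      disjoint_family_on (\<lambda>i. {u i<..<v i}) {..<n::nat} \<longrightarrow> (\<Sum>i<n. v i - u i) < \<delta> \<longrightarrow>
      (\<Sum>i<n. norm (h (v i) - h (u i))) < \<epsilon>"
  proof (intro exI[of _ "min d1 d2"] conjI allI impI)
    fix n and u v :: "nat \<Rightarrow> real"
    assume uv: "\<forall>i\<in>{..<n}. a \<le> u i \<and> u i \<le> v i \<and> v i \<le> b"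
      and disj: "disjoint_family_on (\<lambda>i. {u i<..<v i}) {..<n}"
      and len: "(\<Sum>i<n. v i - u i) < min d1 d2"
    let ?Sf = "\<Sum>i<n. norm (f (v i) - f (u i))" and ?Sg = "\<Sum>i<n. norm (g (v i) - g (u i))"
    have "(\<Sum>i<n. norm (h (v i) - h (u i))) \<le> (\<Sum>i<n. K * (norm (f (v i) - f (u i)) + norm (g (v i) - g (u i))))"
      by (intro sum_mono le) (use uv in auto)
    also have "\<dots> = K * (?Sf + ?Sg)"
      by (simp add: sum.distrib[symmetric] sum_distrib_left)
    also have "\<dots> \<le> \<bar>K\<bar> * (?Sf + ?Sg)"
      by (intro mult_right_mono add_nonneg_nonneg sum_nonneg) auto
    also have "\<dots> \<le> \<bar>K\<bar> * (2 * e)"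
      using d1[rule_format, OF _ _ disj] d2[rule_format, OF _ _ disj] uv len by (intro mult_left_mono) auto
    also have "\<dots> < (\<bar>K\<bar> + 1) * (2 * e)"
      using \<open>e > 0\<close> by (simp add: algebra_simps)
    also have "\<dots> = \<epsilon>"
      by (simp add: e_def field_simps)
    finally show "(\<Sum>i<n. norm (h (v i) - h (u i))) < \<epsilon>" .
  qed (use \<open>d1 > 0\<close> \<open>d2 > 0\<close> in auto)
qed

lemma abs_continuous_ident: "abs_continuous_on_interval a b (\<lambda>t. t)"
proof (rule abs_continuousI)
  fix \<epsilon> :: real
  assume "\<epsilon> > 0"
  have le:  "(\<Sum>i<n. norm (v i - u i)) < \<epsilon>"
    if "\<forall>i\<in>{..<n}. a \<le> u i \<and> u i \<le> v i \<and> v i \<le> b" "(\<Sum>i<n. v i - u i) < \<epsilon>" for n and u v :: "nat \<Rightarrow> real"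
  proof -
    have "(\<Sum>i<n. norm (v i - u i)) = (\<Sum>i<n. v i - u i)"
      using that by (intro sum.cong) auto
    then show ?thesis using that by simp
  qed
  with \<open>\<epsilon> > 0\<close> show "\<exists>\<delta>>0. \<forall>n u v. (\<forall>i\<in>{..<n}. a \<le> u i \<and> u i \<le> v i \<and> v i \<le> b) \<longrightarrow>
      disjoint_family_on (\<lambda>i. {u i<..<v i}) {..<n::nat} \<longrightarrow> (\<Sum>i<n. v i - u i) < \<delta> \<longrightarrow>
      (\<Sum>i<n. norm (v i - u i)) < \<epsilon>"
    by (intro exI[of _ \<epsilon>] conjI allI impI) (auto intro: le)
qed

lemma abs_continuous_Lipschitz:
  fixes f :: "real \<Rightarrow> 'a::real_normed_vector"
  assumes "\<And>s t. a \<le> s \<Longrightarrow> s \<le> t \<Longrightarrow> t \<le> b \<Longrightarrow> norm (f t - f s) \<le> K * (t - s)"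
  shows "abs_continuous_on_interval a b f"
proof (rule abs_continuous_dominated[OF abs_continuous_ident abs_continuous_ident])
  fix s t :: real
  assume "a \<le> s" "s \<le> t" "t \<le> b"
  then show "norm (f t - f s) \<le> K / 2 * (norm (t - s) + norm (t - s))"
    using assms[of s t] by (simp add: algebra_simps)
qed

lemma abs_continuous_has_vector_derivative_bounded:
  fixes f :: "real \<Rightarrow> 'a::real_normed_vector"
  assumes "\<And>t. t \<in> {a..b} \<Longrightarrow> (f has_vector_derivative f' t) (at t within {a..b})"
    and "\<And>t. t \<in> {a..b} \<Longrightarrow> norm (f' t) \<le> K"
  shows "abs_continuous_on_interval a b f"
proof (rule abs_continuous_Lipschitz[where K = K])
  fix s t :: real
  assume "a \<le> s" "s \<le> t" "t \<le> b"
  moreover have "onorm (\<lambda>h. h *\<^sub>R f' r) \<le> K" if "r \<in> {a..b}" for r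
    using assms(2)[OF that] by (intro onorm_le) (simp add: mult.commute[of K] mult_left_mono)
  ultimately have "norm (f t - f s) \<le> K * norm (t - s)"
    using assms(1)
    using \<open>a \<le> s\<close> \<open>t \<le> b\<close>
    by (intro differentiable_bound[where S = "{a..b}" and f' = "\<lambda>x h. h *\<^sub>R f' x"])
      (simp_all add: has_vector_derivative_def)
  then show "norm (f t - f s) \<le> K * (t - s)"
    using \<open>s \<le> t\<close> by simp
qed

lemma abs_continuous_bounded_linear:
  fixes f :: "real \<Rightarrow> 'a::real_normed_vector"
  assumes "bounded_linear L" and f: "abs_continuous_on_interval a b f"
  shows "abs_continuous_on_interval a b (\<lambda>t. L (f t))"
proof -
  interpret bounded_linear L by fact
  obtain K where "K \<ge> 0" "\<And>x. norm (L x) \<le> norm x * K"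
    using nonneg_bounded by blast
  then have "norm (L (f t) - L (f s)) \<le> K / 2 * (norm (f t - f s) + norm (f t - f s))" for s t
    by (simp add: diff[symmetric] mult.commute)
  then show ?thesis
    by (intro abs_continuous_dominated[OF f f])
qed

lemma abs_continuous_add:
  fixes f g :: "real \<Rightarrow> 'a::real_normed_vector"
  assumes "abs_continuous_on_interval a b f" "abs_continuous_on_interval a b g"
  shows "abs_continuous_on_interval a b (\<lambda>t. f t + g t)"
  using assms
proof (rule abs_continuous_dominated)
  fix s t :: real
  show "norm (f t + g t - (f s + g s)) \<le> 1 * (norm (f t - f s) + norm (g t - g s))"
    using norm_triangle_ineq[of "f t - f s" "g t - g s"] by (simp add: algebra_simps)
qed

lemma abs_continuous_sum:
  fixes f :: "'i \<Rightarrow> real \<Rightarrow> 'a::real_normed_vector"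
  assumes "\<And>i. i \<in> I \<Longrightarrow> abs_continuous_on_interval a b (f i)"
  shows "abs_continuous_on_interval a b (\<lambda>t. \<Sum>i\<in>I. f i t)"
  using assms
proof (induction I rule: infinite_finite_induct)
  case (insert i I)
  then show ?case by (simp add: abs_continuous_add)
qed (auto intro: abs_continuous_Lipschitz[where K = 0])

lemma abs_continuous_imp_continuous_on:
  fixes f :: "real \<Rightarrow> 'a::real_normed_vector"
  assumes f: "abs_continuous_on_interval a b f"
  shows "continuous_on {a..b} f"
  unfolding continuous_on_iff
proof (intro ballI allI impI)
  fix s \<epsilon> :: real
  assume s: "s \<in> {a..b}" and "\<epsilon> > 0"
  obtain d where "d > 0" and d: "\<forall>I u v. finite (I :: unit set) \<longrightarrow> (\<forall>i\<in>I. a \<le> u i \<and> u i \<le> v i \<and> v i \<le> b) \<longrightarrow>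
      disjoint_family_on (\<lambda>i. {u i<..<v i}) I \<longrightarrow> (\<Sum>i\<in>I. v i - u i) < d \<longrightarrow>
      (\<Sum>i\<in>I. norm (f (v i) - f (u i))) < \<epsilon>"
    by (rule abs_continuousE[OF f \<open>\<epsilon> > 0\<close>])
  have close: "norm (f q - f p) < \<epsilon>" if "a \<le> p" "p \<le> q" "q \<le> b" "q - p < d" for p q
    using that d[rule_format, of UNIV "\<lambda>_. p" "\<lambda>_. q"] by (simp add: disjoint_family_on_def)
  have "dist (f t) (f s) < \<epsilon>" if t: "t \<in> {a..b}" "dist t s < d" for t
    using s t close[of s t] close[of t s]
    by (cases "s \<le> t") (simp_all add: dist_norm norm_minus_commute)
  then show "\<exists>d>0. \<forall>t\<in>{a..b}. dist t s < d \<longrightarrow> dist (f t) (f s) < \<epsilon>"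
    using \<open>d > 0\<close> by blast
qed

lemma abs_continuous_subinterval:
  fixes f :: "real \<Rightarrow> 'a::real_normed_vector"
  assumes "abs_continuous_on_interval a b f" "a \<le> c" "d \<le> b"
  shows "abs_continuous_on_interval c d f"
proof (rule abs_continuousI)
  fix \<epsilon> :: real
  assume "\<epsilon> > 0"
  obtain \<delta> where "\<delta> > 0" and \<delta>: "\<forall>I u v. finite (I :: nat set) \<longrightarrow> (\<forall>i\<in>I. a \<le> u i \<and> u i \<le> v i \<and> v i \<le> b) \<longrightarrow>
      disjoint_family_on (\<lambda>i. {u i<..<v i}) I \<longrightarrow> (\<Sum>i\<in>I. v i - u i) < \<delta> \<longrightarrow>
      (\<Sum>i\<in>I. norm (f (v i) - f (u i))) < \<epsilon>"
    by (rule abs_continuousE[OF assms(1) \<open>\<epsilon> > 0\<close>])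
  have "(\<Sum>i<n. norm (f (v i) - f (u i))) < \<epsilon>"
    if "\<forall>i\<in>{..<n}. c \<le> u i \<and> u i \<le> v i \<and> v i \<le> d" "disjoint_family_on (\<lambda>i. {u i<..<v i}) {..<n}"
      "(\<Sum>i<n. v i - u i) < \<delta>" for n and u v :: "nat \<Rightarrow> real"
    using that assms(2,3) by (intro \<delta>[rule_format]) force+
  with \<open>\<delta> > 0\<close> show "\<exists>\<delta>>0. \<forall>n u v. (\<forall>i\<in>{..<n}. c \<le> u i \<and> u i \<le> v i \<and> v i \<le> d) \<longrightarrow>
      disjoint_family_on (\<lambda>i. {u i<..<v i}) {..<n::nat} \<longrightarrow> (\<Sum>i<n. v i - u i) < \<delta> \<longrightarrow>
      (\<Sum>i<n. norm (f (v i) - f (u i))) < \<epsilon>"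
    by blast
qed

text \<open>An increment of the product splits into two terms with one increment each; the other
  factor is bounded because the functions are continuous on a compact interval.\<close>

lemma (in bounded_bilinear) abs_continuous:
  assumes f: "abs_continuous_on_interval a b f" and g: "abs_continuous_on_interval a b g"
  shows "abs_continuous_on_interval a b (\<lambda>t. prod (f t) (g t))"
proof -
  obtain K where K: "K > 0" "\<And>x y. norm (prod x y) \<le> norm x * norm y * K"
    using pos_bounded by blast
  have "bounded (f ` {a..b})" "bounded (g ` {a..b})"
    using f g by (auto intro!: compact_imp_bounded compact_continuous_image abs_continuous_imp_continuous_on)
  then obtain M1 M2 where "\<forall>t\<in>{a..b}. norm (f t) \<le> M1" "\<forall>t\<in>{a..b}. norm (g t) \<le> M2"
    by (auto simp: bounded_iff)
  then have M: "norm (f t) \<le> max M1 M2" "norm (g t) \<le> max M1 M2" if "t \<in> {a..b}" for t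
    using that by (auto intro: max.coboundedI1 max.coboundedI2)
  from f g show ?thesis
  proof (rule abs_continuous_dominated)
    fix s t :: real
    assume st: "a \<le> s" "s \<le> t" "t \<le> b"
    have "prod (f t) (g t) - prod (f s) (g s) = prod (f t - f s) (g t) + prod (f s) (g t - g s)"
      by (simp add: diff_left diff_right)
    also have "norm \<dots> \<le> norm (f t - f s) * norm (g t) * K + norm (f s) * norm (g t - g s) * K"
      by (intro norm_triangle_le add_mono K)
    also have "\<dots> \<le> norm (f t - f s) * max M1 M2 * K + max M1 M2 * norm (g t - g s) * K"
      using st K(1) by (intro add_mono mult_mono M mult_nonneg_nonneg order_trans[OF norm_ge_zero M(1)[of s]]) auto
    finally show "norm (prod (f t) (g t) - prod (f s) (g s)) \<le> (max M1 M2 * K) * (norm (f t - f s) + norm (g t - g s))"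
      by (simp add: algebra_simps)
  qed
qed

text \<open>The gauge confines the intervals tagged in \<open>S\<close> to an open set of small measure, where absolute
  continuity bounds the sum of the increments.\<close>
theorem fundamental_theorem_of_calculus_abs_continuous:
  fixes f :: "real \<Rightarrow> 'a::banach"
  assumes "a \<le> b" and ac: "abs_continuous_on_interval a b f" and "negligible S"
    and deriv: "\<And>x. x \<in> {a..b} - S \<Longrightarrow> (f has_vector_derivative f' x) (at x within {a..b})"
  shows "(f' has_integral (f b - f a)) {a..b}"
proof (cases "a = b")
  case True
  then show ?thesis
    using has_integral_refl(2)[of f' b] by simp
next
  case False
  with \<open>a \<le> b\<close> have "a < b" by simp
  \<comment> \<open>With the integrand \<open>0\<close> on the null set, a piece tagged there
    contributes only the increment of \<open>f\<close>, whatever values \<open>f'\<close> takes on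
    \<open>S\<close>.\<close>
  define g where "g x = (if x \<in> S then 0 else f' x)" for x
  have "(g has_integral (f b - f a)) (cbox a b)"
    unfolding has_integral_factor_content
  proof (intro allI impI)
    fix e :: real
    assume "e > 0"
    define e2 where "e2 = e / 2"
    have "e2 > 0" "e2 * (b - a) > 0"
      using \<open>e > 0\<close> \<open>a < b\<close> by (simp_all add: e2_def)
    obtain \<delta> where "\<delta> > 0" and \<delta>: "\<forall>I u v. finite (I :: (real \<times> real set) set) \<longrightarrow>
        (\<forall>i\<in>I. a \<le> u i \<and> u i \<le> v i \<and> v i \<le> b) \<longrightarrow>
        disjoint_family_on (\<lambda>i. {u i<..<v i}) I \<longrightarrow> (\<Sum>i\<in>I. v i - u i) < \<delta> \<longrightarrow>
        (\<Sum>i\<in>I. norm (f (v i) - f (u i))) < e2 * (b - a)"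
      by (rule abs_continuousE[OF ac \<open>e2 * (b - a) > 0\<close>])
    have "S \<in> null_sets lebesgue"
      using \<open>negligible S\<close> by (simp add: negligible_iff_null_sets)
    then have "S \<in> sets lebesgue" by blast
    obtain U where "open U" "S \<subseteq> U" "U - S \<in> lmeasurable" and U: "emeasure lebesgue (U - S) < ennreal \<delta>"
      by (rule sets_lebesgue_outer_open[OF \<open>S \<in> sets lebesgue\<close> \<open>\<delta> > 0\<close>])
    have "U \<in> sets lebesgue"
      using \<open>open U\<close> by (simp add: lborelD)
    then have "emeasure lebesgue U < ennreal \<delta>"
      using U emeasure_Diff_null_set[OF \<open>S \<in> null_sets lebesgue\<close>] by simp
    moreover from this have "U \<in> lmeasurable"
      using \<open>U \<in> sets lebesgue\<close> by (intro fmeasurableI) (auto intro: order_less_trans)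
    ultimately have "measure lebesgue U < \<delta>"
      by (simp add: emeasure_eq_measure2 ennreal_less_iff)
    \<comment> \<open>The gauge has two jobs: off \<open>S\<close> it makes the linear approximation
      good to \<open>e2\<close>, on \<open>S\<close> it keeps the ball inside \<open>U\<close>,
      whose measure is below \<open>\<delta>\<close>. Each part receives half of the error
      \<open>e\<close>.\<close>
    have "\<exists>d>0. (x \<in> {a..b} - S \<longrightarrow> (\<forall>y\<in>{a..b}. norm (y - x) < d \<longrightarrow>
        norm (f y - f x - (y - x) *\<^sub>R f' x) \<le> e2 * norm (y - x))) \<and> (x \<in> S \<longrightarrow> ball x d \<subseteq> U)" for x
    proof (cases "x \<in> S")
      case True
      then show ?thesis
        using \<open>open U\<close> \<open>S \<subseteq> U\<close> open_contains_ball by blast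
    next
      case False
      have "\<exists>d>0. \<forall>y\<in>{a..b}. norm (y - x) < d \<longrightarrow>
          norm (f y - f x - (y - x) *\<^sub>R f' x) \<le> e2 * norm (y - x)" if "x \<in> {a..b} - S"
        using deriv[OF that] \<open>e2 > 0\<close> unfolding has_vector_derivative_def has_derivative_within_alt
        by blast
      with False show ?thesis
        by (cases "x \<in> {a..b}") (auto intro: exI[of _ 1])
    qed
    then have "\<forall>x. \<exists>d>0. (x \<in> {a..b} - S \<longrightarrow> (\<forall>y\<in>{a..b}. norm (y - x) < d \<longrightarrow>
        norm (f y - f x - (y - x) *\<^sub>R f' x) \<le> e2 * norm (y - x))) \<and> (x \<in> S \<longrightarrow> ball x d \<subseteq> U)"
      by blast
    then obtain d where d_pos: "\<And>x. d x > 0"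
      and d: "\<And>x y. x \<in> {a..b} \<Longrightarrow> x \<notin> S \<Longrightarrow> y \<in> {a..b} \<Longrightarrow> norm (y - x) < d x \<Longrightarrow>
        norm (f y - f x - (y - x) *\<^sub>R f' x) \<le> e2 * norm (y - x)"
      and dU: "\<And>x. x \<in> S \<Longrightarrow> ball x (d x) \<subseteq> U"
      unfolding choice_iff by blast
    show "\<exists>\<gamma>. gauge \<gamma> \<and> (\<forall>p. p tagged_division_of (cbox a b) \<and> \<gamma> fine p \<longrightarrow>
        norm ((\<Sum>(x, K)\<in>p. measure lborel K *\<^sub>R g x) - (f b - f a)) \<le> e * measure lborel (cbox a b))"
    proof (intro exI conjI allI impI)
      show "gauge (\<lambda>x. ball x (d x))"
        using d_pos gauge_ball_dependent by blast
      fix p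
      assume "p tagged_division_of (cbox a b) \<and> (\<lambda>x. ball x (d x)) fine p"
      then have p: "p tagged_division_of (cbox a b)" and fine: "(\<lambda>x. ball x (d x)) fine p"
        by auto
      have fin: "finite p"
        using p by blast
      have piece: "K = {Inf K..Sup K}" "Inf K \<le> x" "x \<le> Sup K" "a \<le> Inf K" "Sup K \<le> b"
        "K \<subseteq> ball x (d x)" "measure lborel K = Sup K - Inf K" if xK: "(x, K) \<in> p" for x K
      proof -
        obtain u v where K: "K = cbox u v"
          using p xK by blast
        have "x \<in> K" "K \<subseteq> cbox a b"
          using p xK by blast+
        moreover from this K have "u \<le> v" by auto
        ultimately show "K = {Inf K..Sup K}" "Inf K \<le> x" "x \<le> Sup K" "a \<le> Inf K" "Sup K \<le> b"
          "measure lborel K = Sup K - Inf K"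
          using K by auto
        show "K \<subseteq> ball x (d x)"
          using fine xK by blast
      qed
      let ?D = "\<lambda>(x, K). measure lborel K *\<^sub>R g x - (f (Sup K) - f (Inf K))"
      define q where "q = {(x, K) \<in> p. x \<in> S}"
      have "q \<subseteq> p"
        by (auto simp: q_def)
      then have "finite q"
        using fin finite_subset by blast
      have "f b - f a = (\<Sum>(x, K)\<in>p. f (Sup K) - f (Inf K))"
        using additive_tagged_division_1[of a b p f] \<open>a \<le> b\<close> p by simp
      then have "(\<Sum>(x, K)\<in>p. measure lborel K *\<^sub>R g x) - (f b - f a) = (\<Sum>i\<in>p. ?D i)"
        by (simp add: sum_subtractf[symmetric] case_prod_unfold)
      also have "\<dots> = (\<Sum>i\<in>q. ?D i) + (\<Sum>i\<in>p - q. ?D i)"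
        by (simp add: sum.subset_diff[OF \<open>q \<subseteq> p\<close> fin])
      finally have split: "(\<Sum>(x, K)\<in>p. measure lborel K *\<^sub>R g x) - (f b - f a) = (\<Sum>i\<in>q. ?D i) + (\<Sum>i\<in>p - q. ?D i)" .
      have "norm (\<Sum>i\<in>q. ?D i) \<le> (\<Sum>i\<in>q. norm (f (Sup (snd i)) - f (Inf (snd i))))"
      proof (rule sum_norm_le)
        fix i assume "i \<in> q"
        then show "norm (?D i) \<le> norm (f (Sup (snd i)) - f (Inf (snd i)))"
          by (cases i) (simp add: q_def g_def norm_minus_commute)
      qed
      also have "\<dots> < e2 * (b - a)"
      proof (rule \<delta>[rule_format, OF \<open>finite q\<close>])
        fix i assume "i \<in> q"
        then have "(fst i, snd i) \<in> p"
          using \<open>q \<subseteq> p\<close> by auto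
        from piece(2-5)[OF this] show "a \<le> Inf (snd i) \<and> Inf (snd i) \<le> Sup (snd i) \<and> Sup (snd i) \<le> b"
          by linarith
      next
        show disj: "disjoint_family_on (\<lambda>i. {Inf (snd i)<..<Sup (snd i)}) q"
          unfolding disjoint_family_on_def
        proof (intro ballI impI)
          fix i j assume ij: "i \<in> q" "j \<in> q" "i \<noteq> j"
          obtain x K y L where "i = (x, K)" "j = (y, L)"
            by fastforce
          moreover from this have "interior K \<inter> interior L = {}"
            using p ij \<open>q \<subseteq> p\<close> by (metis subsetD tagged_division_ofD(5))
          moreover have "interior K = {Inf K<..<Sup K}" "interior L = {Inf L<..<Sup L}"
            using piece(1)[of x K] piece(1)[of y L] ij \<open>q \<subseteq> p\<close> calculation(1,2)
            by (metis interior_atLeastAtMost_real subsetD)+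
          ultimately show "{Inf (snd i)<..<Sup (snd i)} \<inter> {Inf (snd j)<..<Sup (snd j)} = {}"
            by simp
        qed
        have "(\<Sum>i\<in>q. Sup (snd i) - Inf (snd i)) = (\<Sum>i\<in>q. measure lebesgue {Inf (snd i)<..<Sup (snd i)})"
          using piece(2,3) \<open>q \<subseteq> p\<close> by (intro sum.cong refl) (force intro: order_trans)
        also have "\<dots> = measure lebesgue (\<Union>i\<in>q. {Inf (snd i)<..<Sup (snd i)})"
          by (intro measure_finite_Union[symmetric] \<open>finite q\<close> disj) (auto simp: emeasure_lborel_box_eq simp flip: box_real(1))
        also have "\<dots> \<le> measure lebesgue U"
        proof (rule measure_mono_fmeasurable)
          have "{Inf K<..<Sup K} \<subseteq> U" if "(x, K) \<in> q" for x K
          proof -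
            have "(x, K) \<in> p" "x \<in> S"
              using that by (auto simp: q_def)
            have "{Inf K<..<Sup K} \<subseteq> {Inf K..Sup K}" by auto
            also have "\<dots> = K" using piece(1)[OF \<open>(x, K) \<in> p\<close>] by simp
            also have "\<dots> \<subseteq> ball x (d x)" by (rule piece(6)[OF \<open>(x, K) \<in> p\<close>])
            also have "\<dots> \<subseteq> U" by (rule dU[OF \<open>x \<in> S\<close>])
            finally show ?thesis .
          qed
          then show "(\<Union>i\<in>q. {Inf (snd i)<..<Sup (snd i)}) \<subseteq> U"
            by force
        qed (use \<open>finite q\<close> \<open>U \<in> lmeasurable\<close> in auto)
        also have "\<dots> < \<delta>" by fact
        finally show "(\<Sum>i\<in>q. Sup (snd i) - Inf (snd i)) < \<delta>" .
      qed
      finally have le1: "norm (\<Sum>i\<in>q. ?D i) \<le> e2 * (b - a)" by simp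
      have "norm (\<Sum>i\<in>p - q. ?D i) \<le> (\<Sum>i\<in>p - q. e2 * (Sup (snd i) - Inf (snd i)))"
      proof (rule sum_norm_le)
        fix i assume "i \<in> p - q"
        then obtain x K where i: "i = (x, K)" and xK: "(x, K) \<in> p" and "x \<notin> S"
          by (auto simp: q_def)
        note pc = piece[OF xK]
        have "Inf K \<in> K" "Sup K \<in> K"
          using pc(1-3) by (metis atLeastAtMost_iff order_refl order_trans)+
        then have close: "norm (Inf K - x) < d x" "norm (Sup K - x) < d x"
          using pc(6) by (auto simp: dist_norm norm_minus_commute)
        have 1: "norm (f (Inf K) - f x - (Inf K - x) *\<^sub>R f' x) \<le> e2 * norm (Inf K - x)"
          by (rule d) (use close \<open>x \<notin> S\<close> pc(2-5) in auto)
        have 2: "norm (f (Sup K) - f x - (Sup K - x) *\<^sub>R f' x) \<le> e2 * norm (Sup K - x)"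
          by (rule d) (use close \<open>x \<notin> S\<close> pc(2-5) in auto)
        \<comment> \<open>Straddling: the tag lies between the end points, so its distances to them
          add up to the length of the piece, and the two errors sum to \<open>e2\<close> times that
          length.\<close>
        have "?D i = (f (Inf K) - f x - (Inf K - x) *\<^sub>R f' x) - (f (Sup K) - f x - (Sup K - x) *\<^sub>R f' x)"
          using \<open>x \<notin> S\<close> by (simp add: i g_def pc(7) scaleR_left_diff_distrib)
        also have "norm \<dots> \<le> e2 * norm (Inf K - x) + e2 * norm (Sup K - x)"
          by (intro norm_triangle_le_diff add_mono 1 2)
        also have "\<dots> = e2 * (Sup K - Inf K)"
          using pc(2,3) by (simp add: algebra_simps)
        finally show "norm (?D i) \<le> e2 * (Sup (snd i) - Inf (snd i))"
          by (simp add: i)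
      qed
      also have "\<dots> \<le> (\<Sum>i\<in>p. e2 * (Sup (snd i) - Inf (snd i)))"
        using fin \<open>e2 > 0\<close> piece(2,3) by (intro sum_mono2) (force intro: order_trans)+
      also have "\<dots> = e2 * (b - a)"
        using additive_tagged_division_1[of a b p "\<lambda>x. x"] \<open>a \<le> b\<close> p
        by (simp add: sum_distrib_left[symmetric] case_prod_unfold)
      finally have "norm (\<Sum>i\<in>p - q. ?D i) \<le> e2 * (b - a)" .
      with le1 show "norm ((\<Sum>(x, K)\<in>p. measure lborel K *\<^sub>R g x) - (f b - f a)) \<le> e * measure lborel (cbox a b)"
        unfolding split using \<open>a \<le> b\<close> by (intro norm_triangle_le) (simp add: e2_def)
    qed
  qed
  then show ?thesis
    using has_integral_spike[OF \<open>negligible S\<close>, of "{a..b}" f' g] by (simp add: g_def)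
qed

section \<open>Positive definite matrices\<close>

text \<open>The quadratic form attains its maximum on the unit sphere of \<open>V\<close> by
  compactness. Allowing an invariant subspace \<open>V\<close> is what the dimension induction for a
  full eigenbasis requires.\<close>

lemma symmetric_matrix_eigenvector:
  fixes A :: "real^'n^'n"
  assumes sym: "transpose A = A" and "subspace V" and inv: "\<And>x. x \<in> V \<Longrightarrow> A *v x \<in> V"
    and "u \<in> V" "u \<noteq> 0"
  obtains v c where "v \<in> V" "norm v = 1" "A *v v = c *\<^sub>R v"
proof -
  have adj: "(A *v x) \<bullet> y = x \<bullet> (A *v y)" for x y
    using sym by (simp add: inner_matrix_vector_mult_left)
  let ?S = "V \<inter> sphere 0 1"
  have "compact ?S"
    using closed_subspace[OF \<open>subspace V\<close>] by (intro closed_Int_compact) auto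
  moreover have "u /\<^sub>R norm u \<in> ?S"
    using \<open>subspace V\<close> \<open>u \<in> V\<close> \<open>u \<noteq> 0\<close> by (simp add: subspace_scale)
  moreover have "continuous_on ?S (\<lambda>x. x \<bullet> (A *v x))"
    by (intro continuous_intros matrix_vector_mult.continuous_on)
  ultimately have "\<exists>x\<in>?S. \<forall>y\<in>?S. y \<bullet> (A *v y) \<le> x \<bullet> (A *v x)"
    by (intro continuous_attains_sup) auto
  then obtain v where v: "v \<in> ?S" and max: "\<And>x. x \<in> ?S \<Longrightarrow> x \<bullet> (A *v x) \<le> v \<bullet> (A *v v)"
    by blast
  \<comment> \<open>At a maximiser \<open>v\<close> of the Rayleigh quotient, its first variation in the direction of the defect
    \<open>A v - c v\<close> is the squared norm of that defect.\<close>
  define c where "c = v \<bullet> (A *v v)"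
  define w where "w = A *v v - c *\<^sub>R v"
  have vv: "v \<bullet> v = 1" "v \<in> V"
    using v by (auto simp: norm_eq_1)
  have "w \<in> V"
    using \<open>subspace V\<close> vv inv by (simp add: w_def subspace_diff subspace_scale)
  have quad: "x \<bullet> (A *v x) \<le> c * (x \<bullet> x)" if "x \<in> V" for x
  proof (cases "x = 0")
    case False
    then have "x /\<^sub>R norm x \<in> ?S"
      using that \<open>subspace V\<close> by (simp add: subspace_scale)
    from max[OF this] have "(x \<bullet> (A *v x)) / (norm x)\<^sup>2 \<le> c"
      by (simp add: c_def matrix_vector_mult.scaleR_right power2_eq_square field_simps)
    then show ?thesis
      using False by (simp add: field_simps power2_norm_eq_inner)
  qed (simp add: matrix_vector_mult.zero_right)
  have "w \<bullet> v = 0"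
    using vv by (simp add: w_def c_def inner_diff_left inner_commute[of "A *v v" v])
  then have wAv: "w \<bullet> (A *v v) = w \<bullet> w"
    by (simp add: w_def inner_diff_right inner_diff_left)
  \<comment> \<open>The bound \<open>quad\<close> at \<open>v + s *\<^sub>R w\<close>: the constant
    terms cancel, so the term linear in \<open>s\<close> has to be dominated by the quadratic one,
    for all \<open>s\<close>.\<close>
  have ineq: "2 * s * (w \<bullet> w) \<le> s\<^sup>2 * (c * (w \<bullet> w) - w \<bullet> (A *v w))" for s
  proof -
    have "v + s *\<^sub>R w \<in> V"
      using \<open>subspace V\<close> vv \<open>w \<in> V\<close> by (simp add: subspace_add subspace_scale)
    from quad[OF this] show ?thesis
      using vv \<open>w \<bullet> v = 0\<close> wAv adj[of v w]
      by (simp add: matrix_vector_mult.scaleR_right matrix_vector_mult.add_right inner_add_left inner_add_right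
          inner_commute c_def[symmetric] algebra_simps power2_eq_square)
  qed
  have "w \<bullet> w = 0"
  proof (rule ccontr)
    assume "w \<bullet> w \<noteq> 0"
    then have "w \<bullet> w > 0" by simp
    \<comment> \<open>\<open>k\<close> is positive and bounds the quadratic coefficient; with
      \<open>s\<close> as below the quadratic term is at most \<open>s * (w \<bullet> w)\<close>,
      half of the linear term.\<close>
    define k where "k = \<bar>c * (w \<bullet> w) - w \<bullet> (A *v w)\<bar> + 1"
    have "k > 0" by (simp add: k_def)
    define s where "s = (w \<bullet> w) / k"
    have "s > 0" using \<open>w \<bullet> w > 0\<close> \<open>k > 0\<close> by (simp add: s_def)
    have "2 * s * (w \<bullet> w) \<le> s\<^sup>2 * k"
      by (rule order_trans[OF ineq]) (auto simp: k_def intro!: mult_left_mono)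
    also have "\<dots> = s * (w \<bullet> w)"
      using \<open>k > 0\<close> by (simp add: s_def power2_eq_square)
    finally show False
      using \<open>s > 0\<close> \<open>w \<bullet> w > 0\<close> by simp
  qed
  then have "A *v v = c *\<^sub>R v"
    by (simp add: w_def)
  then show thesis
    using that v by auto
qed

text \<open>Split off one unit eigenvector; its orthogonal complement within the invariant subspace
  is again invariant because \<open>A\<close> is symmetric, and it has smaller dimension.\<close>

theorem symmetric_matrix_eigenbasis:
  fixes A :: "real^'n^'n"
  assumes sym: "transpose A = A"
  obtains B where "finite B" "pairwise orthogonal B" "\<And>b. b \<in> B \<Longrightarrow> norm b = 1"
    "\<And>b. b \<in> B \<Longrightarrow> A *v b = (b \<bullet> (A *v b)) *\<^sub>R b" "span B = UNIV"
proof -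
  have "\<exists>B \<subseteq> V. finite B \<and> pairwise orthogonal B \<and> (\<forall>b\<in>B. norm b = 1 \<and> A *v b = (b \<bullet> (A *v b)) *\<^sub>R b) \<and> span B = V"
    if "subspace V" "\<And>x. x \<in> V \<Longrightarrow> A *v x \<in> V" for V
    using that
  proof (induction "dim V" arbitrary: V rule: less_induct)
    case less
    show ?case
    proof (cases "V = {0}")
      case True
      then show ?thesis by (intro exI[of _ "{}"]) auto
    next
      case False
      then obtain u where "u \<in> V" "u \<noteq> 0"
        using subspace_0[OF less.prems(1)] by blast
      then obtain v c where v: "v \<in> V" "norm v = 1" "A *v v = c *\<^sub>R v"
        using symmetric_matrix_eigenvector[OF sym less.prems] by blast
      define W where "W = {x \<in> V. x \<bullet> v = 0}"
      have "subspace W"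
        using less.prems(1) unfolding W_def subspace_def by (auto simp: inner_add_left)
      moreover have "A *v x \<in> W" if "x \<in> W" for x
        using that less.prems(2) sym v(3) by (simp add: W_def inner_matrix_vector_mult_left)
      moreover have "dim W < dim V"
      proof (rule dim_psubset)
        have "v \<in> V - W" "W \<subseteq> V"
          using v by (auto simp: W_def)
        then show "span W \<subset> span V"
          using \<open>subspace W\<close> less.prems(1) span_eq_iff by blast
      qed
      ultimately obtain B where B: "B \<subseteq> W" "finite B" "pairwise orthogonal B"
        "\<forall>b\<in>B. norm b = 1 \<and> A *v b = (b \<bullet> (A *v b)) *\<^sub>R b" "span B = W"
        using less.hyps by blast
      have "V \<subseteq> span (insert v B)"
      proof
        fix x assume "x \<in> V"
        then have "x - (x \<bullet> v) *\<^sub>R v \<in> span B"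
          using v less.prems(1) unfolding B(5) W_def
          by (simp add: subspace_diff subspace_scale inner_diff_left norm_eq_1)
        then show "x \<in> span (insert v B)"
          using span_breakdown_eq by blast
      qed
      moreover have "span (insert v B) \<subseteq> V"
        using B(1) v(1) less.prems(1) by (intro span_minimal) (auto simp: W_def)
      moreover have "pairwise orthogonal (insert v B)"
        using B(1,3) by (auto simp: pairwise_insert orthogonal_def W_def inner_commute)
      moreover have "A *v v = (v \<bullet> (A *v v)) *\<^sub>R v"
        using v by (simp add: norm_eq_1)
      ultimately show ?thesis
        using B v by (intro exI[of _ "insert v B"]) (auto simp: W_def)
    qed
  qed
  from this[of UNIV] show thesis
    using that by auto
qed

text \<open>\<open>matrix_sqrt\<close> is a definite description, so uniqueness counts as much as
  existence. The root scales each vector of an orthonormal eigenbasis by the square root of its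
  eigenvalue.\<close>

lemma pos_def_matrix_root:
  fixes A :: "real^'n^'n"
  assumes A: "pos_def_matrix A"
  shows "\<exists>!S. pos_def_matrix S \<and> S ** S = A"
proof -
  have "transpose A = A" and pos: "\<And>x. x \<noteq> 0 \<Longrightarrow> 0 < x \<bullet> (A *v x)"
    using A by (auto simp: pos_def_matrix_def)
  then obtain B where B: "finite B" "pairwise orthogonal B" "\<And>b. b \<in> B \<Longrightarrow> norm b = 1"
    "\<And>b. b \<in> B \<Longrightarrow> A *v b = (b \<bullet> (A *v b)) *\<^sub>R b" "span B = UNIV"
    using symmetric_matrix_eigenbasis by metis
  define c where "c b = sqrt (b \<bullet> (A *v b))" for b
  have c: "c b > 0" "c b * c b = b \<bullet> (A *v b)" if "b \<in> B" for b
    using that B(3) pos[of b] by (force simp: c_def)+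
  have eqI: "R = S" if "\<And>b. b \<in> B \<Longrightarrow> R *v b = S *v b" for R S :: "real^'n^'n"
  proof -
    have "R *v x = S *v x" for x
      by (rule linear_eq_on_span[of _ _ B]) (use that B(5) in auto)
    then show ?thesis by (simp add: matrix_eq)
  qed
  define L where "L x = (\<Sum>b\<in>B. (c b * (x \<bullet> b)) *\<^sub>R b)" for x
  have "linear L"
    by (auto intro!: linearI simp: L_def inner_add_left algebra_simps sum.distrib scaleR_sum_right)
  then have S: "matrix L *v x = L x" for x
    by simp
  have Lb: "L b = c b *\<^sub>R b" if "b \<in> B" for b
  proof -
    have "L b = (\<Sum>b'\<in>B. if b' = b then c b *\<^sub>R b else 0)"
      unfolding L_def using B(2,3) that
      by (intro sum.cong) (auto simp: pairwise_def orthogonal_def norm_eq_1)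
    then show ?thesis
      using B(1) that by simp
  qed
  have inner_L: "x \<bullet> L y = (\<Sum>b\<in>B. c b * (x \<bullet> b) * (y \<bullet> b))" for x y
    by (simp add: L_def inner_sum_right mult_ac)
  have "pos_def_matrix (matrix L)"
    unfolding pos_def_matrix_def
  proof (intro conjI allI impI)
    have "(transpose (matrix L) *v x) \<bullet> y = (matrix L *v x) \<bullet> y" for x y
      using inner_L[of x y] inner_L[of y x]
      by (simp add: inner_matrix_vector_mult_left S inner_commute[of "L x"] mult_ac
          del: transpose_matrix_vector)
    then show "transpose (matrix L) = matrix L"
      by (metis matrix_eq vector_eq_rdot)
    fix x :: "real^'n"
    assume "x \<noteq> 0"
    have "\<exists>b\<in>B. x \<bullet> b \<noteq> 0"
    proof (rule ccontr)
      assume "\<not> (\<exists>b\<in>B. x \<bullet> b \<noteq> 0)"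
      then have "x \<bullet> x = 0"
        using orthogonal_to_span[of x B x] B(5) by (simp add: orthogonal_def)
      with \<open>x \<noteq> 0\<close> show False by simp
    qed
    then obtain b where "b \<in> B" "x \<bullet> b \<noteq> 0" by blast
    then have "0 < (\<Sum>b\<in>B. c b * (x \<bullet> b)\<^sup>2)"
      using B(1) c(1) by (intro sum_pos2[of _ b]) (auto intro!: mult_nonneg_nonneg dest: less_imp_le)
    then show "0 < x \<bullet> (matrix L *v x)"
      by (simp add: S inner_L power2_eq_square mult_ac)
  qed
  moreover have "matrix L ** matrix L = A"
    by (rule eqI) (use Lb c(2) B(4) \<open>linear L\<close> in
        \<open>simp add: matrix_vector_mul_assoc[symmetric] S linear_scale\<close>)
  \<comment> \<open>Uniqueness: \<open>(R + c b)(R - c b) b = 0\<close>, and \<open>R + c b\<close> is positive definite.\<close>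
  moreover have "R *v b = c b *\<^sub>R b" if "b \<in> B" and R: "pos_def_matrix R" "R ** R = A" for b R
  proof -
    let ?w = "R *v b - c b *\<^sub>R b"
    have "R *v (R *v b) = (c b * c b) *\<^sub>R b"
      using that B(4) c(2) by (simp add: matrix_vector_mul_assoc)
    then have "R *v ?w = - c b *\<^sub>R ?w"
      by (simp add: matrix_vector_mult.diff_right matrix_vector_mult.scaleR_right algebra_simps)
    then have "?w \<bullet> (R *v ?w) = - c b * (?w \<bullet> ?w)"
      by simp
    then have "?w \<bullet> (R *v ?w) \<le> 0"
      using c(1)[OF \<open>b \<in> B\<close>] by (simp add: mult_nonneg_nonneg)
    then show ?thesis
      using R(1) unfolding pos_def_matrix_def by (metis eq_iff_diff_eq_0 not_le)
  qed
  ultimately show ?thesis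
    by (intro ex1I[of _ "matrix L"]) (auto intro!: eqI simp: S Lb)
qed

lemma pos_def_matrix_sqrt:
  assumes "pos_def_matrix A"
  shows "pos_def_matrix (matrix_sqrt A)" "matrix_sqrt A ** matrix_sqrt A = A"
  using theI'[OF pos_def_matrix_root[OF assms]] unfolding matrix_sqrt_def by auto

lemma matrix_inv_pos_def:
  fixes A :: "real^'n^'n"
  assumes "pos_def_matrix A"
  shows "A ** matrix_inv A = mat 1" "matrix_inv A ** A = mat 1"
proof -
  have "\<forall>x. A *v x = 0 \<longrightarrow> x = 0"
    using assms by (force simp: pos_def_matrix_def)
  then have "invertible A"
    by (metis invertible_left_inverse matrix_left_invertible_ker)
  then show "A ** matrix_inv A = mat 1" "matrix_inv A ** A = mat 1"
    unfolding invertible_def matrix_inv_def by (metis (mono_tags, lifting) someI_ex)+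
qed

lemma sq_norm_wrt_nonneg:
  assumes "pos_def_matrix S"
  shows "0 \<le> sq_norm_wrt S a"
proof -
  \<comment> \<open>This substitution turns the quadratic form of the inverse into that of
    \<open>S\<close> at \<open>matrix_inv S *v a\<close>.\<close>
  have "a = S *v (matrix_inv S *v a)"
    using matrix_inv_pos_def[OF assms] by (simp add: matrix_vector_mul_assoc)
  then have "sq_norm_wrt S a = (matrix_inv S *v a) \<bullet> (S *v (matrix_inv S *v a))"
    by (simp add: sq_norm_wrt_def inner_commute)
  then show ?thesis
    using assms by (cases "matrix_inv S *v a = 0") (auto simp: pos_def_matrix_def less_imp_le)
qed

section \<open>Square integrable functions\<close>

text \<open>Bridge from the Lebesgue integrals of the definitions to the gauge integral of the
  proofs; for the nonnegative squared norm the two notions of integrability agree.\<close>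

lemma square_integrable_iff:
  "square_integrable_on_interval a b g \<longleftrightarrow>
    g \<in> borel_measurable (lebesgue_on {a..b}) \<and> (\<lambda>t. (norm (g t))\<^sup>2) integrable_on {a..b}"
  unfolding square_integrable_on_interval_def set_borel_measurable_def
  by (simp add: borel_measurable_restrict_space_iff absolutely_integrable_on_iff_nonneg)

lemma square_integrable_continuous:
  assumes "continuous_on {a..b} g"
  shows "square_integrable_on_interval a b g"
  unfolding square_integrable_iff
  using assms
  by (auto intro!: continuous_imp_measurable_on_sets_lebesgue integrable_continuous_real continuous_intros)

lemma square_integrable_dominated:
  fixes f :: "real \<Rightarrow> real^'i" and g :: "real \<Rightarrow> real^'j" and h :: "real \<Rightarrow> real^'k"
  assumes f: "square_integrable_on_interval a b f" and g: "square_integrable_on_interval a b g"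
    and h: "h \<in> borel_measurable (lebesgue_on {a..b})"
    and le: "\<And>t. t \<in> {a..b} \<Longrightarrow> norm (h t) \<le> K * (norm (f t) + norm (g t))"
  shows "square_integrable_on_interval a b h"
  unfolding square_integrable_iff
proof
  show "(\<lambda>t. (norm (h t))\<^sup>2) integrable_on {a..b}"
  proof (rule measurable_bounded_by_integrable_imp_integrable)
    show "(\<lambda>t. 2 * K\<^sup>2 * ((norm (f t))\<^sup>2 + (norm (g t))\<^sup>2)) integrable_on {a..b}"
      using f g unfolding square_integrable_iff
      by (intro integrable_on_mult_right integrable_add) auto
    fix t assume "t \<in> {a..b}"
    then have "(norm (h t))\<^sup>2 \<le> (K * (norm (f t) + norm (g t)))\<^sup>2"
      by (intro power_mono le) auto
    also have "\<dots> \<le> K\<^sup>2 * (2 * ((norm (f t))\<^sup>2 + (norm (g t))\<^sup>2))"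
      unfolding power_mult_distrib using sum_squares_bound[of "norm (f t)" "norm (g t)"]
      by (intro mult_left_mono) (auto simp: power2_sum)
    finally show "norm ((norm (h t))\<^sup>2) \<le> 2 * K\<^sup>2 * ((norm (f t))\<^sup>2 + (norm (g t))\<^sup>2)"
      by (simp add: algebra_simps)
  qed (use h in auto)
qed fact

lemma square_integrable_add:
  assumes f: "square_integrable_on_interval a b f" and g: "square_integrable_on_interval a b g"
  shows "square_integrable_on_interval a b (\<lambda>t. f t + g t)"
  using f g
proof (rule square_integrable_dominated)
  show "norm (f t + g t) \<le> 1 * (norm (f t) + norm (g t))" for t
    using norm_triangle_ineq[of "f t" "g t"] by simp
qed (use f g in \<open>auto simp: square_integrable_iff\<close>)

lemma square_integrable_sum:
  assumes "\<And>i. i \<in> I \<Longrightarrow> square_integrable_on_interval a b (f i)"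
  shows "square_integrable_on_interval a b (\<lambda>t. \<Sum>i\<in>I. f i t)"
  using assms
proof (induction I rule: infinite_finite_induct)
  case (insert i I)
  then show ?case by (simp add: square_integrable_add)
qed (auto intro: square_integrable_continuous)

lemma square_integrable_matrix_vector_mult:
  fixes M :: "real^'i^'j"
  assumes f: "square_integrable_on_interval a b f"
  shows "square_integrable_on_interval a b (\<lambda>t. M *v f t)"
proof -
  obtain K where "K \<ge> 0" "\<And>x. norm (M *v x) \<le> norm x * K"
    using bounded_linear.nonneg_bounded[OF matrix_vector_mult.bounded_linear_right] by metis
  then have "norm (M *v f t) \<le> K / 2 * (norm (f t) + norm (f t))" for t
    by (simp add: mult.commute)
  moreover have "(\<lambda>t. M *v f t) \<in> borel_measurable (lebesgue_on {a..b})"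
    using f borel_measurable_continuous_onI[OF matrix_vector_mult.continuous_on[OF continuous_on_const continuous_on_id]]
    unfolding square_integrable_iff by (auto intro: measurable_compose)
  ultimately show ?thesis
    using square_integrable_dominated[OF f f] by blast
qed

lemma square_integrable_subinterval:
  assumes "square_integrable_on_interval a b g" "a \<le> c" "d \<le> b"
  shows "square_integrable_on_interval c d g"
  using assms unfolding square_integrable_iff
  by (auto intro: integrable_on_subinterval measurable_restrict_mono)

text \<open>On a bounded interval square integrability gives integrability through
  \<open>r \<le> 1 + r\<^sup>2\<close>; the continuous factor \<open>M\<close> is bounded
  there.\<close>

lemma absolutely_integrable_square_integrable:
  fixes M :: "real \<Rightarrow> real^'i^'j"
  assumes M: "continuous_on {a..b} M" and u: "square_integrable_on_interval a b u"
  shows "(\<lambda>t. M t *v u t) absolutely_integrable_on {a..b}"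
proof -
  obtain K where K: "K > 0" "\<And>X x. norm ((X::real^'i^'j) *v x) \<le> norm X * norm x * K"
    using matrix_vector_mult.pos_bounded by blast
  have "bounded (M ` {a..b})"
    using M by (intro compact_imp_bounded compact_continuous_image) auto
  then obtain C where C: "\<forall>t\<in>{a..b}. norm (M t) \<le> C"
    by (auto simp: bounded_iff)
  have "(\<lambda>t. M t *v u t) \<in> borel_measurable (lebesgue_on {a..b})"
  proof (rule borel_measurable_continuous_Pair[where H = "(*v)"])
    show "M \<in> borel_measurable (lebesgue_on {a..b})"
      using M by (intro continuous_imp_measurable_on_sets_lebesgue) auto
    show "u \<in> borel_measurable (lebesgue_on {a..b})"
      using u unfolding square_integrable_iff by blast
    show "continuous_on UNIV (\<lambda>x :: (real^'i^'j) \<times> (real^'i). fst x *v snd x)"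
      by (intro matrix_vector_mult.continuous_on continuous_intros)
  qed
  then show ?thesis
  proof (rule measurable_bounded_by_integrable_imp_absolutely_integrable)
    show "(\<lambda>t. \<bar>C\<bar> * K * (1 + (norm (u t))\<^sup>2)) integrable_on {a..b}"
      using u unfolding square_integrable_iff
      by (intro integrable_on_mult_right integrable_add) auto
    fix t assume "t \<in> {a..b}"
    have "norm (M t *v u t) \<le> norm (M t) * norm (u t) * K"
      by (rule K(2))
    also have "\<dots> \<le> \<bar>C\<bar> * (1 + (norm (u t))\<^sup>2) * K"
    proof (intro mult_mono mult_right_mono)
      show "norm (M t) \<le> \<bar>C\<bar>"
        using C \<open>t \<in> {a..b}\<close> by fastforce
      show "norm (u t) \<le> 1 + (norm (u t))\<^sup>2"
        using sum_squares_bound[of 1 "norm (u t)"] norm_ge_zero[of "u t"]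
        unfolding power_one mult_1_right by linarith
    qed (use K(1) in auto)
    finally show "norm (M t *v u t) \<le> \<bar>C\<bar> * K * (1 + (norm (u t))\<^sup>2)"
      by (simp add: mult_ac)
  qed auto
qed

lemma square_integrable_spike:
  assumes f: "square_integrable_on_interval a b f" and "negligible S"
    and eq: "\<And>t. t \<in> {a..b} - S \<Longrightarrow> g t = f t"
  shows "square_integrable_on_interval a b g"
  unfolding square_integrable_iff
proof
  \<comment> \<open>Measurability of \<open>g\<close> is inherited from \<open>f\<close> by way of
    absolute integrability, which is insensitive to null sets.\<close>
  have "f absolutely_integrable_on {a..b}"
    using absolutely_integrable_square_integrable[OF continuous_on_const f, of "mat 1"] by simp
  then have "g absolutely_integrable_on {a..b}"
    by (rule absolutely_integrable_spike[OF _ \<open>negligible S\<close>]) (rule eq)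
  then show "g \<in> borel_measurable (lebesgue_on {a..b})"
    by (intro absolutely_integrable_measurable[THEN iffD1, THEN conjunct1]) auto
  have "(\<lambda>t. (norm (f t))\<^sup>2) integrable_on {a..b}"
    using f unfolding square_integrable_iff by blast
  then show "(\<lambda>t. (norm (g t))\<^sup>2) integrable_on {a..b}"
    by (rule integrable_spike[OF _ \<open>negligible S\<close>]) (simp add: eq)
qed

lemma square_integrable_indicator:
  assumes "continuous_on {a..b} g"
  shows "square_integrable_on_interval a b (\<lambda>t. indicator {c<..<d} t *\<^sub>R g t)"
proof -
  have g: "square_integrable_on_interval a b g"
    using assms by (rule square_integrable_continuous)
  then have "g \<in> borel_measurable (lebesgue_on {a..b})"
    unfolding square_integrable_iff by blast
  moreover have "(indicator {c<..<d} :: real \<Rightarrow> real) \<in> borel_measurable (lebesgue_on {a..b})"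
    by (intro measurable_restrict_space1 borel_measurable_indicator) auto
  ultimately have "(\<lambda>t. indicator {c<..<d} t *\<^sub>R g t) \<in> borel_measurable (lebesgue_on {a..b})"
    by (intro borel_measurable_scaleR)
  then show ?thesis
    by (rule square_integrable_dominated[OF g g, where K = 1]) (simp add: indicator_def)
qed

text \<open>Used to turn equality of energies into equality of inputs off an explicit negligible
  set.\<close>

lemma has_integral_0_AE:
  fixes f :: "real \<Rightarrow> real"
  assumes "(f has_integral 0) S" and nonneg: "\<And>x. x \<in> S \<Longrightarrow> 0 \<le> f x"
  obtains G where "negligible G" "\<And>x. x \<in> S - G \<Longrightarrow> f x = 0"
proof -
  have "f absolutely_integrable_on S"
    using assms by (simp add: absolutely_integrable_on_iff_nonneg has_integral_integrable)
  then have int: "integrable lebesgue (\<lambda>x. indicator S x *\<^sub>R f x)"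
    and "(LINT x:S|lebesgue. f x) = integral S f"
    by (auto simp: set_integrable_def set_lebesgue_integral_eq_integral)
  then have "(LINT x|lebesgue. indicator S x *\<^sub>R f x) = 0"
    using assms(1) by (simp add: set_lebesgue_integral_def integral_unique)
  then have "AE x in lebesgue. indicator S x *\<^sub>R f x = 0"
    using integral_nonneg_eq_0_iff_AE[OF int] nonneg by (auto simp: indicator_def)
  then obtain G where "G \<in> null_sets lebesgue" and G: "{x \<in> space lebesgue. indicator S x *\<^sub>R f x \<noteq> 0} \<subseteq> G"
    unfolding eventually_ae_filter by blast
  have "negligible G"
    using \<open>G \<in> null_sets lebesgue\<close> by (simp add: negligible_iff_null_sets)
  moreover have "f x = 0" if "x \<in> S - G" for x
    using G that by (auto simp: indicator_def)
  ultimately show thesis by (rule that)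
qed

section \<open>Minimum energy control of linear systems\<close>

text \<open>In the derivative of \<open>matrix_exp ((b - s) *\<^sub>R A) *v z s\<close> the drift
  terms cancel and only the input survives. The product is absolutely continuous, so integrating
  this derivative is legitimate despite the exceptional set \<open>S\<close>.\<close>

lemma variation_of_constants:
  fixes A :: "real^'n^'n" and B :: "real^'m^'n"
  assumes "a \<le> b" and z: "abs_continuous_on_interval a b z" and "negligible S"
    and deriv: "\<And>s. s \<in> {a..b} - S \<Longrightarrow> (z has_vector_derivative A *v z s + B *v u s) (at s within {a..b})"
  shows "((\<lambda>s. matrix_exp ((b - s) *\<^sub>R A) *v (B *v u s)) has_integral
    z b - matrix_exp ((b - a) *\<^sub>R A) *v z a) {a..b}"
proof -
  let ?E = "\<lambda>s. matrix_exp ((b - s) *\<^sub>R A)"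
  have "continuous_on {a..b} (\<lambda>s. ?E s ** A)"
    by (intro matrix_mult.continuous_on continuous_on_matrix_exp continuous_on_const)
  then have "bounded ((\<lambda>s. ?E s ** A) ` {a..b})"
    by (intro compact_imp_bounded compact_continuous_image) auto
  then obtain K where K: "\<forall>s\<in>{a..b}. norm (?E s ** A) \<le> K"
    by (auto simp: bounded_iff)
  have "abs_continuous_on_interval a b ?E"
    by (rule abs_continuous_has_vector_derivative_bounded[OF has_vector_derivative_matrix_exp_shift, where K = K])
      (use K in simp)
  then have "abs_continuous_on_interval a b (\<lambda>s. ?E s *v z s)"
    using z by (rule matrix_vector_mult.abs_continuous)
  moreover have "((\<lambda>s. ?E s *v z s) has_vector_derivative ?E s *v (B *v u s)) (at s within {a..b})"
    if "s \<in> {a..b} - S" for s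
    using matrix_vector_mult.has_vector_derivative[OF has_vector_derivative_matrix_exp_shift deriv[OF that], of b A]
    by (simp add: matrix_vector_mult.add_right matrix_vector_mult.minus_left matrix_vector_mul_assoc)
  ultimately have "((\<lambda>s. ?E s *v (B *v u s)) has_integral ?E b *v z b - ?E a *v z a) {a..b}"
    by (rule fundamental_theorem_of_calculus_abs_continuous[OF \<open>a \<le> b\<close> _ \<open>negligible S\<close>])
  then show ?thesis
    by (simp add: matrix_exp_0)
qed

definition gramian :: "real^'n^'n \<Rightarrow> real^'m^'n \<Rightarrow> real \<Rightarrow> real^'n^'n" where
  "gramian A B h = integral {0..h} (\<lambda>s. matrix_exp ((h - s) *\<^sub>R A) ** B **
     (transpose B ** transpose (matrix_exp ((h - s) *\<^sub>R A))))"

text \<open>Let \<open>L\<close> map an input on \<open>[a, b]\<close> to its effect on the state at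
  time \<open>b\<close>. The Gramian is \<open>L\<close> composed with its adjoint, and this is the
  adjoint of \<open>L\<close> applied to the inverse Gramian at \<open>r\<close>: the preimage of
  \<open>r\<close> under \<open>L\<close> of least norm.\<close>

definition optimal_control :: "real^'n^'n \<Rightarrow> real^'m^'n \<Rightarrow> real \<Rightarrow> real \<Rightarrow> real^'n \<Rightarrow> real \<Rightarrow> real^'m" where
  "optimal_control A B a b r s =
     (transpose B ** transpose (matrix_exp ((b - s) *\<^sub>R A))) *v (matrix_inv (gramian A B (b - a)) *v r)"

lemma continuous_on_gramian_integrand:
  fixes A :: "real^'n^'n" and B :: "real^'m^'n"
  shows "continuous_on S (\<lambda>s. matrix_exp ((b - s) *\<^sub>R A) ** B)"
    "continuous_on S (\<lambda>s. transpose B ** transpose (matrix_exp ((b - s) *\<^sub>R A)))"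
    "continuous_on S (\<lambda>s. matrix_exp ((b - s) *\<^sub>R A) ** B ** (transpose B ** transpose (matrix_exp ((b - s) *\<^sub>R A))))"
  by (intro matrix_mult.continuous_on continuous_on_matrix_exp continuous_on_const
      bounded_linear.continuous_on[OF bounded_linear_transpose])+

text \<open>The Gramian depends on the length of the interval only; translation by \<open>a\<close>
  carries \<open>{0..b - a}\<close> to \<open>{a..b}\<close>.\<close>

lemma has_integral_gramian:
  fixes A :: "real^'n^'n" and B :: "real^'m^'n"
  shows "((\<lambda>s. matrix_exp ((b - s) *\<^sub>R A) ** B ** (transpose B ** transpose (matrix_exp ((b - s) *\<^sub>R A))))
    has_integral gramian A B (b - a)) {a..b}"
proof -
  have "((\<lambda>s. matrix_exp ((b - a - s) *\<^sub>R A) ** B ** (transpose B ** transpose (matrix_exp ((b - a - s) *\<^sub>R A))))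
    has_integral gramian A B (b - a)) {0..b - a}"
    unfolding gramian_def
    by (intro integrable_integral integrable_continuous_real continuous_on_gramian_integrand)
  from has_integral_affinity'[OF this[folded box_real], of 1 "- a"] show ?thesis
    by (simp add: algebra_simps)
qed

lemma continuous_on_optimal_control:
  fixes A :: "real^'n^'n" and B :: "real^'m^'n"
  shows "continuous_on S (optimal_control A B a b r)"
  unfolding optimal_control_def[abs_def]
  by (intro matrix_vector_mult.continuous_on continuous_on_gramian_integrand continuous_on_const)

lemma has_integral_optimal_control:
  fixes A :: "real^'n^'n" and B :: "real^'m^'n"
  assumes "pos_def_matrix (gramian A B (b - a))"
  shows "((\<lambda>s. matrix_exp ((b - s) *\<^sub>R A) *v (B *v optimal_control A B a b r s)) has_integral r) {a..b}"
proof -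
  let ?p = "matrix_inv (gramian A B (b - a)) *v r"
  have "((\<lambda>M. M *v ?p) \<circ> (\<lambda>s. matrix_exp ((b - s) *\<^sub>R A) ** B ** (transpose B ** transpose (matrix_exp ((b - s) *\<^sub>R A))))
      has_integral gramian A B (b - a) *v ?p) {a..b}"
    by (intro has_integral_linear has_integral_gramian matrix_vector_mult.bounded_linear_left)
  then show ?thesis
    using matrix_inv_pos_def[OF assms] by (simp add: o_def optimal_control_def matrix_vector_mul_assoc matrix_mul_assoc)
qed

text \<open>Both \<open>u\<close> and the optimal input steer to \<open>r\<close>, so their inner
  products with the optimal input are the same number \<open>r \<bullet> ?p\<close>. In the expanded
  square the cross term removes it twice and the last term restores it once.\<close>

lemma optimal_control_energy:
  fixes A :: "real^'n^'n" and B :: "real^'m^'n"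
  assumes W: "pos_def_matrix (gramian A B (b - a))" and u: "square_integrable_on_interval a b u"
    and r: "((\<lambda>s. matrix_exp ((b - s) *\<^sub>R A) *v (B *v u s)) has_integral r) {a..b}"
  shows "((\<lambda>s. (norm (u s - optimal_control A B a b r s))\<^sup>2) has_integral
    integral {a..b} (\<lambda>s. (norm (u s))\<^sup>2) - sq_norm_wrt (gramian A B (b - a)) r) {a..b}"
proof -
  let ?v = "optimal_control A B a b r" and ?p = "matrix_inv (gramian A B (b - a)) *v r"
  have inner_v: "w \<bullet> ?v s = (matrix_exp ((b - s) *\<^sub>R A) *v (B *v w)) \<bullet> ?p" for w s
    by (simp add: optimal_control_def inner_matrix_vector_mult_left matrix_vector_mul_assoc
        matrix_transpose_mul matrix_mul_assoc del: transpose_matrix_vector)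
  have inner_p: "((\<lambda>s. (g s) \<bullet> ?p) has_integral r \<bullet> ?p) {a..b}" if "(g has_integral r) {a..b}" for g
    using has_integral_linear[OF that bounded_linear_inner_left[of ?p]] by (simp add: o_def)
  have "((\<lambda>s. u s \<bullet> ?v s) has_integral r \<bullet> ?p) {a..b}" "((\<lambda>s. ?v s \<bullet> ?v s) has_integral r \<bullet> ?p) {a..b}"
    unfolding inner_v by (intro inner_p r has_integral_optimal_control[OF W])+
  moreover have "((\<lambda>s. (norm (u s))\<^sup>2) has_integral integral {a..b} (\<lambda>s. (norm (u s))\<^sup>2)) {a..b}"
    using u unfolding square_integrable_iff by (intro integrable_integral) auto
  ultimately have "((\<lambda>s. (norm (u s))\<^sup>2 - 2 * (u s \<bullet> ?v s) + ?v s \<bullet> ?v s) has_integral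
      integral {a..b} (\<lambda>s. (norm (u s))\<^sup>2) - 2 * (r \<bullet> ?p) + r \<bullet> ?p) {a..b}"
    by (intro has_integral_add has_integral_diff has_integral_mult_right)
  moreover have "(norm (u s - ?v s))\<^sup>2 = (norm (u s))\<^sup>2 - 2 * (u s \<bullet> ?v s) + ?v s \<bullet> ?v s" for s
    by (simp add: power2_norm_eq_inner inner_diff_left inner_diff_right inner_commute)
  ultimately show ?thesis
    by (simp add: sq_norm_wrt_def)
qed

text \<open>The quadratic form at \<open>p\<close> integrates a continuous nonnegative function. If
  the integral is zero, the function vanishes identically, and controllability gives
  \<open>p = 0\<close>.\<close>

lemma pos_def_gramian:
  fixes A :: "real^'n^'n" and B :: "real^'m^'n"
  assumes "h > 0"
    and controllable: "\<And>p. (\<And>s. s \<in> {0..h} \<Longrightarrow> transpose B *v (transpose (matrix_exp (s *\<^sub>R A)) *v p) = 0) \<Longrightarrow> p = 0"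
  shows "pos_def_matrix (gramian A B h)"
  unfolding pos_def_matrix_def
proof (intro conjI allI impI)
  let ?G = "\<lambda>s. matrix_exp ((h - s) *\<^sub>R A) ** B ** (transpose B ** transpose (matrix_exp ((h - s) *\<^sub>R A)))"
  have G: "(?G has_integral gramian A B h) {0..h}"
    using has_integral_gramian[of h A B 0] by simp
  have "((transpose \<circ> ?G) has_integral transpose (gramian A B h)) {0..h}"
    by (rule has_integral_linear[OF G bounded_linear_transpose])
  also have "transpose \<circ> ?G = ?G"
    by (simp add: o_def matrix_transpose_mul matrix_mul_assoc)
  finally show "transpose (gramian A B h) = gramian A B h"
    by (rule has_integral_unique[OF _ G])
  fix p :: "real^'n"
  assume "p \<noteq> 0"
  let ?g = "\<lambda>s. (transpose B ** transpose (matrix_exp ((h - s) *\<^sub>R A))) *v p"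
  have "((\<lambda>M. p \<bullet> (M *v p)) \<circ> ?G has_integral p \<bullet> (gramian A B h *v p)) {0..h}"
    by (rule has_integral_linear[OF G
          bounded_linear_compose[OF bounded_linear_inner_right matrix_vector_mult.bounded_linear_left]])
  moreover have "(\<lambda>M. p \<bullet> (M *v p)) \<circ> ?G = (\<lambda>s. ?g s \<bullet> ?g s)"
    by (simp add: o_def inner_matrix_vector_mult_left matrix_transpose_mul matrix_vector_mul_assoc
        matrix_mul_assoc del: transpose_matrix_vector)
  ultimately have int: "((\<lambda>s. ?g s \<bullet> ?g s) has_integral p \<bullet> (gramian A B h *v p)) {0..h}"
    by simp
  then have "p \<bullet> (gramian A B h *v p) \<ge> 0"
    by (rule has_integral_nonneg) simp
  moreover have "p \<bullet> (gramian A B h *v p) \<noteq> 0"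
  proof
    assume "p \<bullet> (gramian A B h *v p) = 0"
    moreover have "continuous_on {0..h} (\<lambda>s. ?g s \<bullet> ?g s)"
      by (intro continuous_intros matrix_vector_mult.continuous_on continuous_on_gramian_integrand)
    ultimately have zero: "?g s = 0" if "s \<in> {0..h}" for s
      using integral_eq_0_iff[of 0 h "\<lambda>s. ?g s \<bullet> ?g s"] integral_unique[OF int] that \<open>h > 0\<close>
      by simp
    \<comment> \<open>The integrand runs in \<open>h - s\<close>, the hypothesis in
      \<open>s\<close>; reflection of the interval reconciles them.\<close>
    have "transpose B *v (transpose (matrix_exp (s *\<^sub>R A)) *v p) = 0" if "s \<in> {0..h}" for s
      using zero[of "h - s"] that by (simp add: matrix_vector_mul_assoc del: transpose_matrix_vector)
    from controllable[OF this] \<open>p \<noteq> 0\<close> show False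
      by simp
  qed
  ultimately show "0 < p \<bullet> (gramian A B h *v p)" by simp
qed

section \<open>Block structure\<close>

lemma bij_betw_block:
  assumes "CARD('k::{finite,linorder}) = Suc \<nu>"
  shows "bij_betw (block :: nat \<Rightarrow> 'k) {..\<nu>} UNIV"
proof -
  have "bij_betw ((!) (sorted_list_of_set (UNIV :: 'k set))) {..<CARD('k)} (set (sorted_list_of_set (UNIV :: 'k set)))"
    by (rule bij_betw_nth) auto
  then show ?thesis
    using assms unfolding block_def[abs_def] by (simp add: lessThan_Suc_atMost)
qed

lemma block_eq_iff:
  assumes "CARD('k::{finite,linorder}) = Suc \<nu>" "i \<le> \<nu>" "j \<le> \<nu>"
  shows "(block i :: 'k) = block j \<longleftrightarrow> i = j"
  using bij_betw_block[OF assms(1)] assms(2,3) by (auto simp: bij_betw_def dest: inj_onD)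

lemma transpose_E_nth: "(transpose (E m) *v x) $ b = x $ (block m, b)"
proof -
  have "(transpose (E m) *v x) $ b = (\<Sum>p\<in>UNIV. if p = (block m, b) then x $ p else 0)"
    unfolding matrix_vector_mult_def transpose_def E_def vec_lambda_beta
    by (intro sum.cong refl) (auto simp: axis_def mat_def)
  then show ?thesis by simp
qed

lemma E_nth: "(E m *v w) $ p = (if fst p = block m then w $ snd p else 0)"
proof -
  have "(E m *v w) $ p = (\<Sum>b\<in>UNIV. if b = snd p then (if fst p = block m then w $ b else 0) else 0)"
    unfolding matrix_vector_mult_def E_def vec_lambda_beta
    by (intro sum.cong refl) (auto simp: axis_def mat_def)
  then show ?thesis by simp
qed

lemma transpose_E_E:
  assumes "CARD('k::{finite,linorder}) = Suc \<nu>" "i \<le> \<nu>" "j \<le> \<nu>"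
  shows "transpose (E i :: real^'d^('k \<times> 'd)) *v (E j *v w) = (if i = j then w else 0)"
  using assms by (simp add: vec_eq_iff transpose_E_nth E_nth block_eq_iff del: transpose_matrix_vector)

lemma transpose_E_sum:
  assumes "CARD('k::{finite,linorder}) = Suc \<nu>" "m \<le> \<nu>"
  shows "transpose (E m :: real^'d^('k \<times> 'd)) *v (\<Sum>i\<le>\<nu>. E i *v g i) = g m"
  using assms(2)
  by (simp add: matrix_vector_mult.sum_right transpose_E_E[OF assms(1)] cong: sum.cong_simp del: transpose_matrix_vector)

lemma block_vector_eqI:
  fixes x y :: "real^('k::{finite,linorder} \<times> 'd::finite)"
  assumes "CARD('k) = Suc \<nu>" and eq: "\<And>m. m \<le> \<nu> \<Longrightarrow> transpose (E m) *v x = transpose (E m) *v y"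
  shows "x = y"
proof -
  have "x $ (i, b) = y $ (i, b)" for i b
  proof -
    obtain m where "m \<le> \<nu>" "i = block m"
      using bij_betw_block[OF assms(1)] unfolding bij_betw_def by blast
    then show ?thesis
      using eq[of m] transpose_E_nth by metis
  qed
  then show ?thesis by (simp add: vec_eq_iff)
qed

lemma drift_vector_mult:
  fixes z :: "real^('k::{finite,linorder} \<times> 'd::finite)"
  shows "drift \<nu> F *v z = (\<Sum>i<\<nu>. E i *v (transpose (E (Suc i)) *v z))
    + E \<nu> *v (\<Sum>j\<le>\<nu>. F j *v (transpose (E j) *v z))"
  by (simp add: drift_def matrix_vector_mult.add_left matrix_vector_mult.sum_left matrix_vector_mult.sum_right
      matrix_vector_mul_assoc matrix_mul_assoc del: transpose_matrix_vector)

lemma transpose_drift_vector_mult: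
  fixes z :: "real^('k::{finite,linorder} \<times> 'd::finite)"
  shows "transpose (drift \<nu> F) *v z = (\<Sum>i<\<nu>. E (Suc i) *v (transpose (E i) *v z))
    + (\<Sum>j\<le>\<nu>. E j *v (transpose (F j) *v (transpose (E \<nu>) *v z)))"
proof -
  have "transpose (drift \<nu> F :: real^('k \<times> 'd)^('k \<times> 'd)) = (\<Sum>i<\<nu>. E (Suc i) ** transpose (E i))
    + (\<Sum>j\<le>\<nu>. E j ** transpose (F j) ** transpose (E \<nu>))"
    unfolding drift_def linear_add[OF bounded_linear.linear[OF bounded_linear_transpose]]
      linear_sum[OF bounded_linear.linear[OF bounded_linear_transpose]]
    by (simp add: matrix_transpose_mul matrix_mul_assoc)
  then show ?thesis
    by (simp add: matrix_vector_mult.add_left matrix_vector_mult.sum_left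
        matrix_vector_mul_assoc matrix_mul_assoc del: transpose_matrix_vector)
qed

lemma transpose_E_drift:
  fixes z :: "real^('k::{finite,linorder} \<times> 'd::finite)"
  assumes "CARD('k) = Suc \<nu>"
  shows "m < \<nu> \<Longrightarrow> transpose (E m) *v (drift \<nu> F *v z) = transpose (E (Suc m)) *v z"
    and "transpose (E \<nu>) *v (drift \<nu> F *v z) = (\<Sum>j\<le>\<nu>. F j *v (transpose (E j) *v z))"
  unfolding drift_vector_mult
  by (simp_all add: matrix_vector_mult.add_right matrix_vector_mult.sum_right[of _ _ "{..<\<nu>}"] transpose_E_E[OF assms]
      cong: sum.cong_simp del: transpose_matrix_vector)

lemma transpose_E_transpose_drift:
  fixes z :: "real^('k::{finite,linorder} \<times> 'd::finite)"
  assumes "CARD('k) = Suc \<nu>" "m < \<nu>"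
  shows "transpose (E (Suc m)) *v (transpose (drift \<nu> F) *v z) =
    transpose (E m) *v z + transpose (F (Suc m)) *v (transpose (E \<nu>) *v z)"
  using assms(2) unfolding transpose_drift_vector_mult
  by (simp add: matrix_vector_mult.add_right matrix_vector_mult.sum_right[of _ _ "{..<\<nu>}"] transpose_E_sum[OF assms(1)]
      transpose_E_E[OF assms(1)] cong: sum.cong_simp del: transpose_matrix_vector)

text \<open>Block \<open>m + 1\<close> of \<open>g' = F\<^sup>T g\<close> reads \<open>g\<^sub>m\<^sub>+\<^sub>1' = g\<^sub>m + F\<^sub>m\<^sub>+\<^sub>1\<^sup>T g\<^sub>\<nu>\<close>, so vanishing of \<open>g\<^sub>\<nu>\<close> propagates
  downwards to all blocks.\<close>
lemma drift_controllable:
  fixes p :: "real^('k::{finite,linorder} \<times> 'd::finite)" and F :: "nat \<Rightarrow> real^'d^'d"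
  assumes card: "CARD('k) = Suc \<nu>" and "h > 0"
    and zero: "\<And>s. s \<in> {0..h} \<Longrightarrow> transpose (E \<nu>) *v (transpose (matrix_exp (s *\<^sub>R drift \<nu> F)) *v p) = 0"
  shows "p = 0"
proof -
  define g where "g s = transpose (matrix_exp (s *\<^sub>R drift \<nu> F)) *v p" for s
  have deriv: "(g has_vector_derivative transpose (drift \<nu> F) *v g s) (at s within {0..h})" for s
  proof -
    have "(g has_vector_derivative transpose (drift \<nu> F ** matrix_exp (s *\<^sub>R drift \<nu> F)) *v p) (at s within {0..h})"
      unfolding g_def
      by (intro bounded_linear.has_vector_derivative[OF matrix_vector_mult.bounded_linear_left]
          bounded_linear.has_vector_derivative[OF bounded_linear_transpose] has_vector_derivative_matrix_exp)
    then show ?thesis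
      by (simp add: g_def matrix_exp_commute matrix_transpose_mul matrix_vector_mul_assoc
          del: transpose_matrix_vector)
  qed
  have zero_last: "transpose (E \<nu>) *v g s = 0" if "s \<in> {0..h}" for s
    using zero[OF that] by (simp add: g_def)
  \<comment> \<open>Blocks are counted from the last one, so that downward propagation becomes
    ordinary induction on \<open>j\<close>.\<close>
  have block_zero: "transpose (E (\<nu> - j)) *v g s = 0" if "j \<le> \<nu>" "s \<in> {0..h}" for j s
    using that
  proof (induction j arbitrary: s)
    case 0
    then show ?case using zero_last by simp
  next
    case (Suc j)
    define m where "m = \<nu> - Suc j"
    have m: "m < \<nu>" "\<nu> - j = Suc m"
      using Suc.prems by (auto simp: m_def)
    have "((\<lambda>s. transpose (E (Suc m)) *v g s) has_vector_derivative
        transpose (E (Suc m)) *v (transpose (drift \<nu> F) *v g s)) (at s within {0..h})"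
      by (rule bounded_linear.has_vector_derivative[OF matrix_vector_mult.bounded_linear_right deriv])
    moreover have "((\<lambda>s. transpose (E (Suc m)) *v g s) has_vector_derivative 0) (at s within {0..h})"
      using Suc m by (intro has_vector_derivative_transform[OF _ _ has_vector_derivative_const]) auto
    \<comment> \<open>Derivatives within a nondegenerate closed interval are unique also at its end
      points. This keeps the claim valid at \<open>0\<close>, where \<open>g\<close> takes the value
      \<open>p\<close>.\<close>
    ultimately have "transpose (E (Suc m)) *v (transpose (drift \<nu> F) *v g s) = 0"
      using vector_derivative_unique_within_closed_interval[of 0 h s] Suc.prems \<open>h > 0\<close> by auto
    then show ?case
      using transpose_E_transpose_drift[OF card m(1), of F "g s"] zero_last[OF Suc.prems(2)]
      by (simp add: m_def matrix_vector_mult.zero_right del: transpose_matrix_vector)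
  qed
  have "g 0 = 0"
  proof (rule block_vector_eqI[OF card])
    fix m assume "m \<le> \<nu>"
    then show "transpose (E m) *v g 0 = transpose (E m) *v 0"
      using block_zero[of "\<nu> - m" 0] \<open>h > 0\<close> by (simp add: matrix_vector_mult.zero_right del: transpose_matrix_vector)
  qed
  then show ?thesis
    by (simp add: g_def matrix_exp_0)
qed

text \<open>\<open>\<Gamma>\<close> is split into two copies of its symmetric root, one for each
  side of the integrand, which is continuous, so that Lebesgue and gauge integral agree.\<close>

lemma transition_cov_eq_gramian:
  fixes F :: "nat \<Rightarrow> real^'d^'d"
  assumes "pos_def_matrix \<Gamma>"
  shows "(transition_cov \<nu> F \<Gamma> h :: real^('k::{finite,linorder} \<times> 'd)^('k \<times> 'd)) =
    gramian (drift \<nu> F) (E \<nu> ** matrix_sqrt \<Gamma>) h"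
proof -
  let ?A = "drift \<nu> F :: real^('k \<times> 'd)^('k \<times> 'd)" and ?B = "E \<nu> ** matrix_sqrt \<Gamma> :: real^'d^('k \<times> 'd)"
  have sqrt: "transpose (matrix_sqrt \<Gamma>) = matrix_sqrt \<Gamma>" "matrix_sqrt \<Gamma> ** matrix_sqrt \<Gamma> = \<Gamma>"
    using pos_def_matrix_sqrt[OF assms] by (auto simp: pos_def_matrix_def)
  have "transpose (c *\<^sub>R ?A) = c *\<^sub>R transpose ?A" for c
    by (rule linear_cmul[OF bounded_linear.linear[OF bounded_linear_transpose]])
  then have exp: "transpose (matrix_exp (c *\<^sub>R ?A)) = matrix_exp (c *\<^sub>R transpose ?A)" for c
    by (simp add: transpose_matrix_exp)
  have "?B ** transpose ?B = E \<nu> ** (matrix_sqrt \<Gamma> ** matrix_sqrt \<Gamma>) ** transpose (E \<nu>)"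
    by (simp add: matrix_transpose_mul sqrt(1) matrix_mul_assoc)
  then have BB: "?B ** transpose ?B = E \<nu> ** \<Gamma> ** transpose (E \<nu>)"
    by (simp add: sqrt(2))
  have eq: "X ** E \<nu> ** \<Gamma> ** transpose (E \<nu>) ** Z = X ** ?B ** (transpose ?B ** Z)"
    for X Z :: "real^('k \<times> 'd)^('k \<times> 'd)"
  proof -
    have "X ** ?B ** (transpose ?B ** Z) = X ** (?B ** transpose ?B) ** Z"
      by (simp only: matrix_mul_assoc)
    also have "\<dots> = X ** E \<nu> ** \<Gamma> ** transpose (E \<nu>) ** Z"
      by (simp only: BB matrix_mul_assoc)
    finally show ?thesis by simp
  qed
  have "continuous_on {0..h} (\<lambda>s. matrix_exp ((h - s) *\<^sub>R ?A) ** ?B ** (transpose ?B ** transpose (matrix_exp ((h - s) *\<^sub>R ?A))))"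
    by (rule continuous_on_gramian_integrand)
  then have "set_integrable lebesgue {0..h} (\<lambda>s. matrix_exp ((h - s) *\<^sub>R ?A) ** ?B ** (transpose ?B ** transpose (matrix_exp ((h - s) *\<^sub>R ?A))))"
    by (rule absolutely_integrable_continuous_real)
  then show ?thesis
    unfolding transition_cov_def gramian_def eq exp[symmetric] by (rule set_lebesgue_integral_eq_integral)
qed

text \<open>The root of \<open>\<Gamma>\<close> is invertible, so the controllability hypothesis
  reduces to vanishing of the last block, the situation of
  \<open>drift_controllable\<close>.\<close>

lemma pos_def_transition_gramian:
  fixes F :: "nat \<Rightarrow> real^'d^'d"
  assumes "CARD('k::{finite,linorder}) = Suc \<nu>" "pos_def_matrix \<Gamma>" "h > 0"
  shows "pos_def_matrix (gramian (drift \<nu> F) (E \<nu> ** matrix_sqrt \<Gamma>) h :: real^('k \<times> 'd)^('k \<times> 'd))"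
  using \<open>h > 0\<close>
proof (rule pos_def_gramian)
  fix p :: "real^('k \<times> 'd)"
  assume zero: "\<And>s. s \<in> {0..h} \<Longrightarrow> transpose (E \<nu> ** matrix_sqrt \<Gamma>) *v (transpose (matrix_exp (s *\<^sub>R drift \<nu> F)) *v p) = 0"
  have S: "pos_def_matrix (matrix_sqrt \<Gamma>)" "transpose (matrix_sqrt \<Gamma>) = matrix_sqrt \<Gamma>"
    using pos_def_matrix_sqrt[OF assms(2)] by (auto simp: pos_def_matrix_def)
  have "transpose (E \<nu>) *v (transpose (matrix_exp (s *\<^sub>R drift \<nu> F)) *v p) = 0" if "s \<in> {0..h}" for s
  proof -
    let ?w = "transpose (E \<nu>) *v (transpose (matrix_exp (s *\<^sub>R drift \<nu> F)) *v p)"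
    have "matrix_sqrt \<Gamma> *v ?w = 0"
      using zero[OF that] S(2) by (simp add: matrix_transpose_mul matrix_vector_mul_assoc matrix_mul_assoc
          del: transpose_matrix_vector)
    then have "matrix_inv (matrix_sqrt \<Gamma>) *v (matrix_sqrt \<Gamma> *v ?w) = 0"
      by (simp add: matrix_vector_mult.zero_right)
    then show ?thesis
      unfolding matrix_vector_mul_assoc[of _ "matrix_sqrt \<Gamma>"] matrix_inv_pos_def[OF S(1)]
      by (simp only: matrix_vector_mul_lid)
  qed
  then show "p = 0"
    using drift_controllable[OF assms(1,3)] by blast
qed

section \<open>The state equation of the prior\<close>

lemma has_vector_derivative_D:
  assumes "D T m y differentiable (at t within {0..T})"
  shows "(D T m y has_vector_derivative D T (Suc m) y t) (at t within {0..T})"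
  using assms vector_derivative_works by auto

lemma transpose_E_stacked:
  assumes "CARD('k::{finite,linorder}) = Suc \<nu>" "m \<le> \<nu>"
  shows "transpose (E m) *v (stacked \<nu> T y t :: real^('k \<times> 'd::finite)) = D T m y t"
  unfolding stacked_def by (rule transpose_E_sum[OF assms])

lemma transpose_E_input:
  fixes S :: "real^'d^'d"
  assumes "CARD('k::{finite,linorder}) = Suc \<nu>" "m \<le> \<nu>"
  shows "transpose (E m :: real^'d^('k \<times> 'd)) *v ((E \<nu> ** S) *v w) = (if m = \<nu> then S *v w else 0)"
  using assms(2) transpose_E_E[OF assms(1), of m \<nu> "S *v w"]
  by (simp add: matrix_vector_mul_assoc[symmetric] del: transpose_matrix_vector)

text \<open>\<open>A\<close> and \<open>B\<close> are parameters tied down by equations, so that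
  results on general linear systems apply without exposing the block structure.\<close>

locale gauss_markov_prior =
  fixes T :: real and \<nu> :: nat and F :: "nat \<Rightarrow> real^'d^'d" and \<Gamma> :: "real^'d^'d"
    and A :: "real^('k::{finite,linorder} \<times> 'd)^('k \<times> 'd)" and B :: "real^'d^('k \<times> 'd)"
  assumes card: "CARD('k) = Suc \<nu>" and T: "0 < T" and Gamma: "pos_def_matrix \<Gamma>"
    and A_def: "A = drift \<nu> F" and B_def: "B = E \<nu> ** matrix_sqrt \<Gamma>"
begin

lemma abs_continuous_stacked:
  assumes "y \<in> Y_space \<nu> T"
  shows "abs_continuous_on_interval 0 T (stacked \<nu> T y :: real \<Rightarrow> real^('k \<times> 'd))"
  unfolding stacked_def[abs_def] using assms unfolding Y_space_def
  by (intro abs_continuous_sum abs_continuous_bounded_linear[OF matrix_vector_mult.bounded_linear_right]) simp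

text \<open>The blocks before the last say that each derivative is followed by the next; the last
  block is the definition of \<open>A_op\<close> solved for the derivative of order
  \<open>\<nu> + 1\<close>.\<close>

lemma stacked_has_vector_derivative:
  assumes "\<And>m. m \<le> \<nu> \<Longrightarrow> D T m y differentiable (at t within {0..T})"
  shows "(stacked \<nu> T y has_vector_derivative A *v stacked \<nu> T y t + B *v A_op \<nu> T F \<Gamma> y t) (at t within {0..T})"
proof -
  have "(stacked \<nu> T y has_vector_derivative (\<Sum>m\<le>\<nu>. (E m :: real^'d^('k \<times> 'd)) *v D T (Suc m) y t)) (at t within {0..T})"
    unfolding stacked_def[abs_def]
  proof (rule has_vector_derivative_sum)
    fix m assume "m \<in> {..\<nu>}"
    then show "((\<lambda>t. (E m :: real^'d^('k \<times> 'd)) *v D T m y t) has_vector_derivative E m *v D T (Suc m) y t) (at t within {0..T})"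
      by (intro bounded_linear.has_vector_derivative[OF matrix_vector_mult.bounded_linear_right]
          has_vector_derivative_D assms) simp
  qed
  moreover have "(\<Sum>m\<le>\<nu>. E m *v D T (Suc m) y t) = A *v stacked \<nu> T y t + B *v A_op \<nu> T F \<Gamma> y t"
  proof (rule block_vector_eqI[OF card])
    fix m assume m: "m \<le> \<nu>"
    have "matrix_sqrt \<Gamma> *v A_op \<nu> T F \<Gamma> y t = D T (Suc \<nu>) y t - (\<Sum>m\<le>\<nu>. F m *v D T m y t)"
      using matrix_inv_pos_def[OF pos_def_matrix_sqrt(1)[OF Gamma]]
      by (simp add: A_op_def matrix_vector_mul_assoc)
    then have eq: "transpose (E m) *v (A *v stacked \<nu> T y t + B *v A_op \<nu> T F \<Gamma> y t) = D T (Suc m) y t"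
      using m transpose_E_drift(1)[OF card, of m F "stacked \<nu> T y t"] transpose_E_drift(2)[OF card, of F "stacked \<nu> T y t"]
      unfolding A_def B_def
      by (cases "m = \<nu>") (simp_all add: matrix_vector_mult.add_right transpose_E_input[OF card]
          transpose_E_stacked[OF card] del: transpose_matrix_vector D.simps)
    have "transpose (E m) *v (\<Sum>i\<le>\<nu>. (E i :: real^'d^('k \<times> 'd)) *v D T (Suc i) y t) = D T (Suc m) y t"
      by (rule transpose_E_sum[OF card m])
    then show "transpose (E m) *v (\<Sum>i\<le>\<nu>. (E i :: real^'d^('k \<times> 'd)) *v D T (Suc i) y t) =
        transpose (E m) *v (A *v stacked \<nu> T y t + B *v A_op \<nu> T F \<Gamma> y t)"
      unfolding eq .
  qed
  ultimately show ?thesis by simp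
qed

lemma stacked_state_equation:
  assumes y: "y \<in> Y_space \<nu> T"
  obtains S where "negligible S"
    "\<And>t. t \<in> {0..T} - S \<Longrightarrow>
      (stacked \<nu> T y has_vector_derivative A *v stacked \<nu> T y t + B *v A_op \<nu> T F \<Gamma> y t) (at t within {0..T})"
proof -
  have "AE t in lebesgue. t \<in> {0..T} \<longrightarrow> D T \<nu> y differentiable (at t within {0..T})"
    using y by (simp add: Y_space_def)
  then obtain S where "S \<in> null_sets lebesgue"
    and S: "{t \<in> space lebesgue. \<not> (t \<in> {0..T} \<longrightarrow> D T \<nu> y differentiable (at t within {0..T}))} \<subseteq> S"
    unfolding eventually_ae_filter by blast
  show thesis
  proof (rule that)
    show "negligible S"
      using \<open>S \<in> null_sets lebesgue\<close> by (simp add: negligible_iff_null_sets)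
    fix t assume "t \<in> {0..T} - S"
    then have "D T m y differentiable (at t within {0..T})" if "m \<le> \<nu>" for m
      using S y that by (cases "m = \<nu>") (auto simp: Y_space_def)
    then show "(stacked \<nu> T y has_vector_derivative A *v stacked \<nu> T y t + B *v A_op \<nu> T F \<Gamma> y t) (at t within {0..T})"
      by (rule stacked_has_vector_derivative)
  qed
qed

lemma square_integrable_A_op:
  assumes y: "y \<in> Y_space \<nu> T"
  shows "square_integrable_on_interval 0 T (A_op \<nu> T F \<Gamma> y)"
proof -
  have "continuous_on {0..T} (\<lambda>t. - (\<Sum>m\<le>\<nu>. F m *v D T m y t))"
    using y abs_continuous_imp_continuous_on unfolding Y_space_def
    by (intro continuous_on_minus continuous_on_sum matrix_vector_mult.continuous_on continuous_on_const) blast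
  moreover have "square_integrable_on_interval 0 T (D T (Suc \<nu>) y)"
    using y by (simp add: Y_space_def)
  ultimately have "square_integrable_on_interval 0 T
      (\<lambda>t. matrix_inv (matrix_sqrt \<Gamma>) *v (D T (Suc \<nu>) y t + - (\<Sum>m\<le>\<nu>. F m *v D T m y t)))"
    by (intro square_integrable_matrix_vector_mult square_integrable_add[OF _ square_integrable_continuous])
  then show ?thesis
    by (simp add: A_op_def[abs_def])
qed

text \<open>The norm is a real square root, so squaring recovers the inner product only once that is
  known to be nonnegative.\<close>

lemma
  assumes Sigma: "pos_def_matrix (\<Sigma>0 :: real^('k \<times> 'd)^('k \<times> 'd))" and y: "y \<in> Y_space \<nu> T"
  shows Y_norm_nonneg: "0 \<le> Y_norm \<nu> T F \<Gamma> \<Sigma>0 y"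
    and Y_norm_squared: "(Y_norm \<nu> T F \<Gamma> \<Sigma>0 y)\<^sup>2 = sq_norm_wrt \<Sigma>0 (stacked \<nu> T y 0)
      + integral {0..T} (\<lambda>t. (norm (A_op \<nu> T F \<Gamma> y t))\<^sup>2)"
proof -
  let ?u = "A_op \<nu> T F \<Gamma> y"
  have int: "(\<lambda>t. (norm (?u t))\<^sup>2) integrable_on {0..T}"
    using square_integrable_A_op[OF y] unfolding square_integrable_iff by blast
  then have "(\<lambda>t. (norm (?u t))\<^sup>2) absolutely_integrable_on {0..T}"
    by (simp add: absolutely_integrable_on_iff_nonneg)
  then have "(LINT t:{0..T}|lebesgue. (norm (?u t))\<^sup>2) = integral {0..T} (\<lambda>t. (norm (?u t))\<^sup>2)"
    by (rule set_lebesgue_integral_eq_integral)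
  then have eq: "Y_inner \<nu> T F \<Gamma> \<Sigma>0 y y = sq_norm_wrt \<Sigma>0 (stacked \<nu> T y 0) + integral {0..T} (\<lambda>t. (norm (?u t))\<^sup>2)"
    by (simp add: Y_inner_def sq_norm_wrt_def power2_norm_eq_inner)
  moreover have "0 \<le> integral {0..T} (\<lambda>t. (norm (?u t))\<^sup>2)"
    using int by (rule integral_nonneg) simp
  ultimately have "0 \<le> Y_inner \<nu> T F \<Gamma> \<Sigma>0 y y"
    using sq_norm_wrt_nonneg[OF Sigma] by simp
  with eq show "0 \<le> Y_norm \<nu> T F \<Gamma> \<Sigma>0 y" "(Y_norm \<nu> T F \<Gamma> \<Sigma>0 y)\<^sup>2 =
      sq_norm_wrt \<Sigma>0 (stacked \<nu> T y 0) + integral {0..T} (\<lambda>t. (norm (?u t))\<^sup>2)"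
    by (simp_all add: Y_norm_def)
qed

text \<open>Converse of \<open>stacked_state_equation\<close>: the first block of a trajectory is
  the function and the other blocks are its derivatives. The equation is given off \<open>G\<close>
  only, whereas \<open>Y_space\<close> asks for derivatives up to order \<open>\<nu>\<close> at
  every point.\<close>

lemma Y_space_of_state:
  fixes z :: "real \<Rightarrow> real^('k \<times> 'd)"
  assumes z: "abs_continuous_on_interval 0 T z" and "negligible G"
    and deriv: "\<And>t. t \<in> {0..T} - G \<Longrightarrow> (z has_vector_derivative A *v z t + B *v u t) (at t within {0..T})"
    and u: "square_integrable_on_interval 0 T u"
  obtains y where "y \<in> Y_space \<nu> T" "\<And>t m. t \<in> {0..T} \<Longrightarrow> m \<le> \<nu> \<Longrightarrow> D T m y t = transpose (E m) *v z t"
    "\<And>t. t \<in> {0..T} - G \<Longrightarrow> A_op \<nu> T F \<Gamma> y t = u t"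
proof -
  \<comment> \<open>Restricted because members of \<open>Y_space\<close> are
    \<open>undefined\<close> outside the interval.\<close>
  define y where "y = restrict (\<lambda>t. transpose (E 0) *v z t) {0..T}"
  have cont: "continuous_on {0..T} (\<lambda>t. transpose (E m) *v z t)" for m
    by (intro matrix_vector_mult.continuous_on continuous_on_const abs_continuous_imp_continuous_on[OF z])
  have z_deriv: "((\<lambda>t. transpose (E m) *v z t) has_vector_derivative transpose (E m) *v (A *v z t + B *v u t))
      (at t within {0..T})" if "t \<in> {0..T} - G" for t m
    by (rule bounded_linear.has_vector_derivative[OF matrix_vector_mult.bounded_linear_right deriv[OF that]])
  have block_deriv: "((\<lambda>t. transpose (E m) *v z t) has_vector_derivative transpose (E (Suc m)) *v z t) (at t within {0..T})"
    if "t \<in> {0..T}" "m < \<nu>" for t m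
  proof -
    let ?g = "\<lambda>t. transpose (E m) *v z t" and ?g' = "\<lambda>t. transpose (E (Suc m)) *v z t"
    \<comment> \<open>The integral form yields the derivative at the points of \<open>G\<close> as well.\<close>
    have g_eq: "?g s = ?g 0 + integral {0..s} ?g'" if s: "s \<in> {0..T}" for s
    proof -
      have "(?g' has_integral ?g s - ?g 0) {0..s}"
      proof (rule fundamental_theorem_of_calculus_abs_continuous[OF _ _ \<open>negligible G\<close>])
        show "abs_continuous_on_interval 0 s ?g"
          by (rule abs_continuous_subinterval[OF abs_continuous_bounded_linear[OF matrix_vector_mult.bounded_linear_right z]])
            (use s in auto)
        fix r assume r: "r \<in> {0..s} - G"
        then have "(?g has_vector_derivative transpose (E m) *v (A *v z r + B *v u r)) (at r within {0..s})"
          using s by (intro has_vector_derivative_within_subset[OF z_deriv]) auto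
        moreover have "transpose (E m) *v (A *v z r + B *v u r) = ?g' r"
          using \<open>m < \<nu>\<close> unfolding A_def B_def
          by (simp add: matrix_vector_mult.add_right transpose_E_drift[OF card] transpose_E_input[OF card]
              del: transpose_matrix_vector)
        ultimately show "(?g has_vector_derivative ?g' r) (at r within {0..s})"
          by simp
      qed (use s in auto)
      from integral_unique[OF this] show ?thesis
        by (simp del: transpose_matrix_vector)
    qed
    have "((\<lambda>s. ?g 0 + integral {0..s} ?g') has_vector_derivative 0 + ?g' t) (at t within {0..T})"
      by (rule has_vector_derivative_add[OF has_vector_derivative_const integral_has_vector_derivative[OF cont that(1)]])
    then have "((\<lambda>s. ?g 0 + integral {0..s} ?g') has_vector_derivative ?g' t) (at t within {0..T})"
      by simp
    then show ?thesis
      by (rule has_vector_derivative_transform[OF that(1), rotated]) (rule g_eq)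
  qed
  \<comment> \<open>\<open>D\<close> picks some derivative value at each order; since
    \<open>0 < T\<close>, derivatives within \<open>{0..T}\<close> are unique, and induction
    identifies them with the blocks.\<close>
  have D_eq: "D T m y t = transpose (E m) *v z t" if "t \<in> {0..T}" "m \<le> \<nu>" for t m
    using that
  proof (induction m arbitrary: t)
    case 0
    then show ?case by (simp add: y_def)
  next
    case (Suc m)
    then have "(D T m y has_vector_derivative transpose (E (Suc m)) *v z t) (at t within {0..T})"
      by (intro has_vector_derivative_transform[OF _ _ block_deriv]) auto
    then show ?case
      using vector_derivative_within_closed_interval[OF T] Suc.prems(1) by simp
  qed
  have D_deriv: "(D T m y has_vector_derivative transpose (E (Suc m)) *v z t) (at t within {0..T})"
    if "t \<in> {0..T}" "m < \<nu>" for t m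
    using that by (intro has_vector_derivative_transform[OF _ _ block_deriv] D_eq) auto
  \<comment> \<open>The last row of the state equation; it is the derivative of order
    \<open>\<nu> + 1\<close> off \<open>G\<close>.\<close>
  define g where "g t = (\<Sum>j\<le>\<nu>. F j *v (transpose (E j) *v z t)) + matrix_sqrt \<Gamma> *v u t" for t
  have D_last: "(D T \<nu> y has_vector_derivative g t) (at t within {0..T})" if t: "t \<in> {0..T} - G" for t
  proof -
    have "transpose (E \<nu>) *v (A *v z t + B *v u t) = g t"
      unfolding A_def B_def g_def
      by (simp add: matrix_vector_mult.add_right transpose_E_drift[OF card] transpose_E_input[OF card]
          del: transpose_matrix_vector)
    then have "((\<lambda>t. transpose (E \<nu>) *v z t) has_vector_derivative g t) (at t within {0..T})"
      using z_deriv[OF t, of \<nu>] by simp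
    then show ?thesis
      using t by (intro has_vector_derivative_transform[where g = "D T \<nu> y"])
        (auto simp: D_eq simp del: transpose_matrix_vector)
  qed
  have D_Suc: "D T (Suc \<nu>) y t = g t" if "t \<in> {0..T} - G" for t
    using vector_derivative_within_closed_interval[OF T _ D_last[OF that]] that by simp
  show thesis
  proof (rule that[of y])
    have "square_integrable_on_interval 0 T g"
      unfolding g_def
      by (intro square_integrable_add square_integrable_matrix_vector_mult[OF u] square_integrable_continuous
          continuous_on_sum matrix_vector_mult.continuous_on[OF continuous_on_const] cont)
    then have "square_integrable_on_interval 0 T (D T (Suc \<nu>) y)"
      by (rule square_integrable_spike[OF _ \<open>negligible G\<close>]) (rule D_Suc)
    moreover have "abs_continuous_on_interval 0 T (D T m y)" if "m \<le> \<nu>" for m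
    proof -
      have ac: "abs_continuous_on_interval 0 T (\<lambda>t. transpose (E m) *v z t)"
        by (rule abs_continuous_bounded_linear[OF matrix_vector_mult.bounded_linear_right z])
      \<comment> \<open>Domination acts as a congruence rule here: the two functions agree on
        \<open>{0..T}\<close> but need not agree elsewhere.\<close>
      show ?thesis
        by (rule abs_continuous_dominated[OF ac ac, where K = 1])
          (simp add: D_eq that del: transpose_matrix_vector)
    qed
    moreover have "AE t in lebesgue. t \<in> {0..T} \<longrightarrow> D T \<nu> y differentiable (at t within {0..T})"
    proof (rule AE_I')
      show "G \<in> null_sets lebesgue"
        using \<open>negligible G\<close> by (simp add: negligible_iff_null_sets)
      show "{t \<in> space lebesgue. \<not> (t \<in> {0..T} \<longrightarrow> D T \<nu> y differentiable (at t within {0..T}))} \<subseteq> G"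
        using D_last differentiableI_vector by blast
    qed
    moreover have "D T m y differentiable (at t within {0..T})" if "m < \<nu>" "t \<in> {0..T}" for m t
      using D_deriv[OF that(2,1)] by (rule differentiableI_vector)
    ultimately show "y \<in> Y_space \<nu> T"
      unfolding Y_space_def by (simp add: y_def)
    fix t assume t: "t \<in> {0..T} - G"
    then have "D T (Suc \<nu>) y t - (\<Sum>m\<le>\<nu>. F m *v D T m y t) = matrix_sqrt \<Gamma> *v u t"
      unfolding D_Suc[OF t] by (simp add: g_def D_eq del: transpose_matrix_vector)
    then show "A_op \<nu> T F \<Gamma> y t = u t"
      using matrix_inv_pos_def[OF pos_def_matrix_sqrt(1)[OF Gamma]]
      by (simp add: A_op_def matrix_vector_mul_assoc del: D.simps)
  qed (rule D_eq)
qed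

end

section \<open>Interpolation of grid states\<close>

locale gauss_markov_grid = gauss_markov_prior T \<nu> F \<Gamma> A B
  for T :: real and \<nu> :: nat and F :: "nat \<Rightarrow> real^'d^'d" and \<Gamma> :: "real^'d^'d"
    and A :: "real^('k::{finite,linorder} \<times> 'd)^('k \<times> 'd)" and B :: "real^'d^('k \<times> 'd)" +
  fixes N :: nat and t :: "nat \<Rightarrow> real"
  assumes t_0: "t 0 = 0" and t_Suc: "\<And>n. n < N \<Longrightarrow> t n < t (Suc n)" and t_N: "t N = T"
begin

lemma t_less: "i < j \<Longrightarrow> j \<le> N \<Longrightarrow> t i < t j"
proof (induction j)
  case (Suc j)
  have "t j < t (Suc j)"
    using t_Suc[of j] Suc.prems by simp
  moreover have "i = j \<or> t i < t j"
    using Suc by (cases "i = j") auto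
  ultimately show ?case by auto
qed simp

lemma t_le: "i \<le> j \<Longrightarrow> j \<le> N \<Longrightarrow> t i \<le> t j"
  using t_less[of i j] by (cases "i = j") auto

lemma t_range: "n \<le> N \<Longrightarrow> 0 \<le> t n" "n \<le> N \<Longrightarrow> t n \<le> T"
  using t_le[of 0 n] t_le[of n N] t_0 t_N by auto

text \<open>The residual of the overview. It is used for indices from \<open>1\<close> to
  \<open>N\<close> only, where \<open>n - 1\<close> is a true predecessor.\<close>

definition innovation :: "(nat \<Rightarrow> real^('k \<times> 'd)) \<Rightarrow> nat \<Rightarrow> real^('k \<times> 'd)" where
  "innovation x n = x n - matrix_exp ((t n - t (n - 1)) *\<^sub>R A) *v x (n - 1)"

text \<open>The value at the grid points is \<open>0\<close>; it is irrelevant, as the grid is a null set.\<close>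
definition control :: "(nat \<Rightarrow> real^('k \<times> 'd)) \<Rightarrow> real \<Rightarrow> real^'d" where
  "control x s = (\<Sum>n=1..N. indicator {t (n - 1)<..<t n} s *\<^sub>R
     optimal_control A B (t (n - 1)) (t n) (innovation x n) s)"

lemma pos_def_gramian_step:
  assumes "n \<in> {1..N}"
  shows "pos_def_matrix (gramian A B (t n - t (n - 1)))"
  unfolding A_def B_def using assms t_less[of "n - 1" n]
  by (intro pos_def_transition_gramian card Gamma) auto

lemma control_eq:
  assumes n: "n \<in> {1..N}" and s: "s \<in> {t (n - 1)<..<t n}"
  shows "control x s = optimal_control A B (t (n - 1)) (t n) (innovation x n) s"
proof -
  have "indicator {t (m - 1)<..<t m} s = (if m = n then 1 else 0 :: real)" if m: "m \<in> {1..N}" for m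
  proof -
    consider "m = n" | "m < n" | "n < m" by linarith
    then show ?thesis
    proof cases
      case 1
      then show ?thesis using s by simp
    next
      case 2
      then have "t m \<le> t (n - 1)"
        using n by (intro t_le) auto
      then show ?thesis using 2 s by simp
    next
      case 3
      then have "t n \<le> t (m - 1)"
        using m by (intro t_le) auto
      then show ?thesis using 3 s by simp
    qed
  qed
  then have "control x s = (\<Sum>m=1..N. if m = n then optimal_control A B (t (n - 1)) (t n) (innovation x n) s else 0)"
    unfolding control_def by (intro sum.cong refl) simp
  then show ?thesis using n by simp
qed

lemma square_integrable_control: "square_integrable_on_interval 0 T (control x)"
  unfolding control_def[abs_def]
  by (intro square_integrable_sum square_integrable_indicator continuous_on_optimal_control)

lemma bounded_control: "\<exists>K. \<forall>s\<in>{0..T}. norm (control x s) \<le> K"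
proof -
  let ?g = "\<lambda>s. \<Sum>n=1..N. norm (optimal_control A B (t (n - 1)) (t n) (innovation x n) s)"
  have "continuous_on {0..T} ?g"
    by (intro continuous_on_sum continuous_on_norm continuous_on_optimal_control)
  then have "bounded (?g ` {0..T})"
    by (intro compact_imp_bounded compact_continuous_image) auto
  then obtain K where K: "\<forall>s\<in>{0..T}. norm (?g s) \<le> K"
    by (auto simp: bounded_iff)
  have "norm (control x s) \<le> K" if "s \<in> {0..T}" for s
  proof -
    have "norm (control x s) \<le> ?g s"
      unfolding control_def by (intro sum_norm_le) (simp add: indicator_def)
    also have "\<dots> \<le> norm (?g s)" by simp
    also have "\<dots> \<le> K" using K that by blast
    finally show ?thesis .
  qed
  then show ?thesis by blast
qed

text \<open>Away from the grid each indicator is locally constant. Continuity gives the state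
  equation at every point off the grid, so the exceptional set of the steered state is
  finite.\<close>

lemma isCont_control:
  assumes "s \<notin> t ` {0..N}"
  shows "isCont (control x) s"
  unfolding control_def
proof (rule continuous_sum)
  fix n assume n: "n \<in> {1..N}"
  then have "s \<noteq> t (n - 1)" "s \<noteq> t n"
    using assms by auto
  moreover have "t (n - 1) < t n"
    using n by (intro t_less) auto
  ultimately have "s \<notin> frontier {t (n - 1)<..<t n}"
    by (auto simp: frontier_def)
  then have "isCont (indicator {t (n - 1)<..<t n} :: real \<Rightarrow> real) s"
    by (simp add: isCont_indicator)
  moreover have "isCont (optimal_control A B (t (n - 1)) (t n) (innovation x n)) s"
    using continuous_on_optimal_control[of UNIV A B "t (n - 1)" "t n" "innovation x n"]
    by (simp add: continuous_on_eq_continuous_within)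
  ultimately show "isCont (\<lambda>s. indicator {t (n - 1)<..<t n} s *\<^sub>R
      optimal_control A B (t (n - 1)) (t n) (innovation x n) s) s"
    by (rule continuous_scaleR)
qed

lemma innovation_of_state:
  fixes z :: "real \<Rightarrow> real^('k \<times> 'd)"
  assumes z: "abs_continuous_on_interval 0 T z" and "negligible S"
    and deriv: "\<And>s. s \<in> {0..T} - S \<Longrightarrow> (z has_vector_derivative A *v z s + B *v u s) (at s within {0..T})"
    and n: "n \<in> {1..N}"
  shows "((\<lambda>s. matrix_exp ((t n - s) *\<^sub>R A) *v (B *v u s)) has_integral
    z (t n) - matrix_exp ((t n - t (n - 1)) *\<^sub>R A) *v z (t (n - 1))) {t (n - 1)..t n}"
proof (rule variation_of_constants[OF _ _ \<open>negligible S\<close>])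
  have range: "0 \<le> t (n - 1)" "t n \<le> T"
    using t_range n by auto
  show "t (n - 1) \<le> t n"
    using n by (intro t_le) auto
  show "abs_continuous_on_interval (t (n - 1)) (t n) z"
    using z range by (rule abs_continuous_subinterval)
  fix s assume "s \<in> {t (n - 1)..t n} - S"
  then show "(z has_vector_derivative A *v z s + B *v u s) (at s within {t (n - 1)..t n})"
    using range by (intro has_vector_derivative_within_subset[OF deriv]) auto
qed

lemma has_integral_control:
  assumes n: "n \<in> {1..N}"
  shows "((\<lambda>s. matrix_exp ((t n - s) *\<^sub>R A) *v (B *v control x s)) has_integral innovation x n) {t (n - 1)..t n}"
proof (rule has_integral_spike)
  show "negligible {t (n - 1), t n}" by simp
  show "((\<lambda>s. matrix_exp ((t n - s) *\<^sub>R A) *v (B *v optimal_control A B (t (n - 1)) (t n) (innovation x n) s))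
      has_integral innovation x n) {t (n - 1)..t n}"
    by (rule has_integral_optimal_control[OF pos_def_gramian_step[OF n]])
  fix s assume "s \<in> {t (n - 1)..t n} - {t (n - 1), t n}"
  then show "matrix_exp ((t n - s) *\<^sub>R A) *v (B *v control x s) =
      matrix_exp ((t n - s) *\<^sub>R A) *v (B *v optimal_control A B (t (n - 1)) (t n) (innovation x n) s)"
    using control_eq[OF n, of s x] by simp
qed

text \<open>The trajectory is written down by variation of constants from time \<open>0\<close> on
  the whole interval at once, which avoids gluing at the grid points. It passes through every
  \<open>x n\<close> by induction: it starts at \<open>x 0\<close>, and on each step
  \<open>control\<close> produces exactly the prescribed innovation.\<close>

lemma controlled_state:
  obtains z where "abs_continuous_on_interval 0 T z"
    "\<And>s. s \<in> {0..T} - t ` {0..N} \<Longrightarrow> (z has_vector_derivative A *v z s + B *v control x s) (at s within {0..T})"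
    "\<And>n. n \<le> N \<Longrightarrow> z (t n) = x n"
proof -
  define g where "g s = matrix_exp ((0 - s) *\<^sub>R A) *v (B *v control x s)" for s
  define w where "w s = x 0 + integral {0..s} g" for s
  define z where "z s = matrix_exp (s *\<^sub>R A) *v w s" for s
  have "(\<lambda>s. (matrix_exp ((0 - s) *\<^sub>R A) ** B) *v control x s) absolutely_integrable_on {0..T}"
    by (intro absolutely_integrable_square_integrable continuous_on_gramian_integrand square_integrable_control)
  then have int: "g integrable_on {0..T}"
    by (simp add: g_def[abs_def] matrix_vector_mul_assoc set_lebesgue_integral_eq_integral(1))
  have cont_exp: "continuous_on {0..T} (\<lambda>s. matrix_exp ((0 - s) *\<^sub>R A))" "continuous_on {0..T} (\<lambda>s. A ** matrix_exp (s *\<^sub>R A))"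
    by (intro continuous_on_matrix_exp matrix_mult.continuous_on continuous_on_const)+
  obtain K where K: "\<forall>s\<in>{0..T}. norm (A ** matrix_exp (s *\<^sub>R A)) \<le> K"
    using compact_imp_bounded[OF compact_continuous_image[OF cont_exp(2) compact_Icc]] by (auto simp: bounded_iff)
  have ac_exp: "abs_continuous_on_interval 0 T (\<lambda>s. matrix_exp (s *\<^sub>R A))"
    by (rule abs_continuous_has_vector_derivative_bounded[OF has_vector_derivative_matrix_exp, where K = K])
      (use K in simp)
  \<comment> \<open>A bound on the integrand makes \<open>w\<close> Lipschitz, hence absolutely
    continuous.\<close>
  obtain M where M: "\<forall>s\<in>{0..T}. norm (g s) \<le> M"
  proof -
    obtain L1 where L1: "\<forall>s\<in>{0..T}. norm (matrix_exp ((0 - s) *\<^sub>R A) ** B) \<le> L1"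
    proof -
      have "continuous_on {0..T} (\<lambda>s. matrix_exp ((0 - s) *\<^sub>R A) ** B)"
        by (rule continuous_on_gramian_integrand)
      from compact_imp_bounded[OF compact_continuous_image[OF this compact_Icc]] that show thesis
        by (auto simp: bounded_iff)
    qed
    obtain L2 where L2: "\<forall>s\<in>{0..T}. norm (control x s) \<le> L2"
      using bounded_control by blast
    obtain L where L: "L > 0" "\<And>X v. norm ((X :: real^'d^('k \<times> 'd)) *v v) \<le> norm X * norm v * L"
      using matrix_vector_mult.pos_bounded by blast
    have "norm (g s) \<le> \<bar>L1\<bar> * \<bar>L2\<bar> * L" if "s \<in> {0..T}" for s
    proof -
      have "norm (matrix_exp ((0 - s) *\<^sub>R A) ** B) \<le> \<bar>L1\<bar>" "norm (control x s) \<le> \<bar>L2\<bar>"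
        using L1 L2 that by force+
      then have "norm (matrix_exp ((0 - s) *\<^sub>R A) ** B) * norm (control x s) * L \<le> \<bar>L1\<bar> * \<bar>L2\<bar> * L"
        using L(1) by (intro mult_right_mono mult_mono) auto
      with L(2)[of "matrix_exp ((0 - s) *\<^sub>R A) ** B" "control x s"] show ?thesis
        by (simp add: g_def matrix_vector_mul_assoc)
    qed
    then show thesis using that by blast
  qed
  have "M \<ge> 0"
    using M[rule_format, of 0] T by (auto intro: order_trans[OF norm_ge_zero])
  have "abs_continuous_on_interval 0 T w"
  proof (rule abs_continuous_Lipschitz[where K = M])
    fix r s assume rs: "0 \<le> r" "r \<le> s" "s \<le> T"
    have int_s: "g integrable_on {0..s}" "g integrable_on {r..s}"
      using rs by (auto intro: integrable_on_subinterval[OF int])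
    have "w s - w r = integral {r..s} g"
      using Henstock_Kurzweil_Integration.integral_combine[OF rs(1,2) int_s(1)] by (simp add: w_def algebra_simps)
    also have "norm \<dots> \<le> M * measure lborel (cbox r s)"
      using has_integral_bound[OF \<open>M \<ge> 0\<close>, of g _ r s] integrable_integral[OF int_s(2)] M rs by simp
    finally show "norm (w s - w r) \<le> M * (s - r)"
      using rs by simp
  qed
  then have z_ac: "abs_continuous_on_interval 0 T z"
    unfolding z_def by (rule matrix_vector_mult.abs_continuous[OF ac_exp])
  have z_deriv: "(z has_vector_derivative A *v z s + B *v control x s) (at s within {0..T})"
    if s: "s \<in> {0..T} - t ` {0..N}" for s
  proof -
    have "isCont g s"
      unfolding g_def using isCont_control[of s x] s continuous_on_matrix_exp(2)[of UNIV 0 A]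
      by (intro matrix_vector_mult.continuous continuous_const) (auto simp: continuous_on_eq_continuous_within)
    then have "((\<lambda>s. integral {0..s} g) has_vector_derivative g s) (at s within {0..T})"
      using integral_has_vector_derivative_continuous_at[OF int, of s "{}"] s
      by (auto intro: continuous_at_imp_continuous_at_within)
    then have "(w has_vector_derivative 0 + g s) (at s within {0..T})"
      unfolding w_def[abs_def] by (rule has_vector_derivative_add[OF has_vector_derivative_const])
    then have "(z has_vector_derivative matrix_exp (s *\<^sub>R A) *v (0 + g s) + (A ** matrix_exp (s *\<^sub>R A)) *v w s)
        (at s within {0..T})"
      unfolding z_def[abs_def]
      by (rule matrix_vector_mult.has_vector_derivative[OF has_vector_derivative_matrix_exp])
    \<comment> \<open>The forward exponential cancels the backward one inside \<open>g\<close> and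
      leaves the bare input term.\<close>
    then show ?thesis
      using matrix_exp_inverse[of s A]
      by (simp add: z_def g_def matrix_vector_mul_assoc add.commute matrix_mul_assoc)
  qed
  have "z (t n) = x n" if "n \<le> N" for n
    using that
  proof (induction n)
    case 0
    then show ?case by (simp add: t_0 z_def w_def matrix_exp_0)
  next
    case (Suc n)
    then have n: "Suc n \<in> {1..N}" by simp
    have "negligible (t ` {0..N})"
      by (simp add: negligible_finite)
    from innovation_of_state[OF z_ac this z_deriv n] has_integral_control[OF n, of x]
    have "z (t (Suc n)) - matrix_exp ((t (Suc n) - t n) *\<^sub>R A) *v z (t n) = innovation x (Suc n)"
      by (simp add: has_integral_unique)
    then show ?case
      using Suc by (simp add: innovation_def)
  qed
  with z_ac z_deriv show thesis by (rule that)
qed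

text \<open>\<open>optimal_control_energy\<close> on each step, added up over the prefixes
  \<open>{0..t n}\<close>; within a step \<open>control\<close> can differ from the optimal input at
  the two end points only.\<close>

lemma control_energy:
  assumes u: "square_integrable_on_interval 0 T u"
    and r: "\<And>n. n \<in> {1..N} \<Longrightarrow>
      ((\<lambda>s. matrix_exp ((t n - s) *\<^sub>R A) *v (B *v u s)) has_integral innovation x n) {t (n - 1)..t n}"
  shows "((\<lambda>s. (norm (u s - control x s))\<^sup>2) has_integral
    integral {0..T} (\<lambda>s. (norm (u s))\<^sup>2) - (\<Sum>n=1..N. sq_norm_wrt (gramian A B (t n - t (n - 1))) (innovation x n))) {0..T}"
proof -
  have int: "(\<lambda>s. (norm (u s))\<^sup>2) integrable_on {0..T}"
    using u unfolding square_integrable_iff by blast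
  have "((\<lambda>s. (norm (u s - control x s))\<^sup>2) has_integral integral {0..t n} (\<lambda>s. (norm (u s))\<^sup>2)
      - (\<Sum>i=1..n. sq_norm_wrt (gramian A B (t i - t (i - 1))) (innovation x i))) {0..t n}" if "n \<le> N" for n
    using that
  proof (induction n)
    case 0
    then show ?case
      using has_integral_refl(2)[of "\<lambda>s. (norm (u s - control x s))\<^sup>2" 0] by (simp add: t_0)
  next
    case (Suc n)
    then have n: "Suc n \<in> {1..N}" by simp
    have range: "0 \<le> t n" "t n \<le> t (Suc n)" "t (Suc n) \<le> T"
      using Suc.prems t_range t_Suc[of n] by auto
    let ?v = "optimal_control A B (t n) (t (Suc n)) (innovation x (Suc n))"
    have "((\<lambda>s. (norm (u s - ?v s))\<^sup>2) has_integral integral {t n..t (Suc n)} (\<lambda>s. (norm (u s))\<^sup>2)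
        - sq_norm_wrt (gramian A B (t (Suc n) - t n)) (innovation x (Suc n))) {t n..t (Suc n)}"
      using pos_def_gramian_step[OF n] r[OF n] range
      by (intro optimal_control_energy[OF _ square_integrable_subinterval[OF u]]) simp_all
    then have "((\<lambda>s. (norm (u s - control x s))\<^sup>2) has_integral integral {t n..t (Suc n)} (\<lambda>s. (norm (u s))\<^sup>2)
        - sq_norm_wrt (gramian A B (t (Suc n) - t n)) (innovation x (Suc n))) {t n..t (Suc n)}"
    proof (rule has_integral_spike[of "{t n, t (Suc n)}", rotated 2])
      fix s assume "s \<in> {t n..t (Suc n)} - {t n, t (Suc n)}"
      then show "(norm (u s - control x s))\<^sup>2 = (norm (u s - ?v s))\<^sup>2"
        using control_eq[OF n, of s x] by simp
    qed simp
    from has_integral_combine[OF range(1,2) Suc.IH this] Suc.prems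
    have "((\<lambda>s. (norm (u s - control x s))\<^sup>2) has_integral
        integral {0..t n} (\<lambda>s. (norm (u s))\<^sup>2) - (\<Sum>i=1..n. sq_norm_wrt (gramian A B (t i - t (i - 1))) (innovation x i))
        + (integral {t n..t (Suc n)} (\<lambda>s. (norm (u s))\<^sup>2)
        - sq_norm_wrt (gramian A B (t (Suc n) - t n)) (innovation x (Suc n)))) {0..t (Suc n)}"
      by simp
    moreover have "integral {0..t n} (\<lambda>s. (norm (u s))\<^sup>2) + integral {t n..t (Suc n)} (\<lambda>s. (norm (u s))\<^sup>2) =
        integral {0..t (Suc n)} (\<lambda>s. (norm (u s))\<^sup>2)"
      using range by (intro Henstock_Kurzweil_Integration.integral_combine integrable_on_subinterval[OF int]) auto
    ultimately show ?case
      by (simp add: algebra_simps)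
  qed
  from this[of N] show ?thesis
    by (simp add: t_N)
qed

end

section \<open>Comparison of the two objectives through the grid states\<close>

context gauss_markov_grid
begin

lemma states_of_iff:
  fixes x :: "nat \<Rightarrow> real^('k \<times> 'd)"
  shows "states_of \<nu> T N t y x \<longleftrightarrow> (\<forall>n\<le>N. x n = stacked \<nu> T y (t n))"
  unfolding states_of_def
  by (metis block_vector_eqI[OF card] transpose_E_stacked[OF card])

lemma map_objective_eq:
  "map_objective \<nu> F \<Gamma> \<Sigma>0 N t x = 1/2 * sq_norm_wrt \<Sigma>0 (x 0)
    + 1/2 * (\<Sum>n=1..N. sq_norm_wrt (gramian A B (t n - t (n - 1))) (innovation x n))"
  unfolding map_objective_def transition_cov_eq_gramian[OF Gamma] transition_matrix_def
    A_def[symmetric] B_def[symmetric] innovation_def ..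

lemma innovation_of_states:
  assumes y: "y \<in> Y_space \<nu> T" and x: "\<And>n. n \<le> N \<Longrightarrow> x n = stacked \<nu> T y (t n)" and n: "n \<in> {1..N}"
  shows "((\<lambda>s. matrix_exp ((t n - s) *\<^sub>R A) *v (B *v A_op \<nu> T F \<Gamma> y s)) has_integral innovation x n) {t (n - 1)..t n}"
proof -
  obtain S where S: "negligible S" "\<And>s. s \<in> {0..T} - S \<Longrightarrow>
      (stacked \<nu> T y has_vector_derivative A *v stacked \<nu> T y s + B *v A_op \<nu> T F \<Gamma> y s) (at s within {0..T})"
    by (rule stacked_state_equation[OF y]) blast
  have "innovation x n = stacked \<nu> T y (t n) - matrix_exp ((t n - t (n - 1)) *\<^sub>R A) *v stacked \<nu> T y (t (n - 1))"
    using n x[of n] x[of "n - 1"] unfolding innovation_def by force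
  with innovation_of_state[OF abs_continuous_stacked[OF y] S n] show ?thesis by simp
qed

text \<open>Keeping the defect as an integral serves three purposes: its sign gives the lower bound,
  its vanishing shows that steering attains the bound, and it identifies the input of every
  interpolant that attains it.\<close>

lemma Y_norm_decomposition:
  assumes y: "y \<in> Y_space \<nu> T" and "states_of \<nu> T N t y x" and Sigma: "pos_def_matrix (\<Sigma>0 :: real^('k \<times> 'd)^('k \<times> 'd))"
  shows "((\<lambda>s. (norm (A_op \<nu> T F \<Gamma> y s - control x s))\<^sup>2) has_integral
    (Y_norm \<nu> T F \<Gamma> \<Sigma>0 y)\<^sup>2 - 2 * map_objective \<nu> F \<Gamma> \<Sigma>0 N t x) {0..T}"
proof -
  have x: "x n = stacked \<nu> T y (t n)" if "n \<le> N" for n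
    using assms(2) that by (simp add: states_of_iff)
  from control_energy[OF square_integrable_A_op[OF y] innovation_of_states[OF y x]] show ?thesis
    using x[of 0] by (simp add: Y_norm_squared[OF Sigma y] map_objective_eq t_0 algebra_simps)
qed

lemma map_objective_le:
  assumes "y \<in> Y_space \<nu> T" "states_of \<nu> T N t y x"
    "pos_def_matrix (\<Sigma>0 :: real^('k \<times> 'd)^('k \<times> 'd))"
  shows "map_objective \<nu> F \<Gamma> \<Sigma>0 N t x \<le> 1/2 * (Y_norm \<nu> T F \<Gamma> \<Sigma>0 y)\<^sup>2"
  using has_integral_nonneg[OF Y_norm_decomposition[OF assms]] by simp

lemma optimal_interpolant_exists:
  fixes x :: "nat \<Rightarrow> real^('k \<times> 'd)"
  assumes Sigma: "pos_def_matrix \<Sigma>0"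
  obtains y where "y \<in> Y_space \<nu> T" "states_of \<nu> T N t y x"
    "1/2 * (Y_norm \<nu> T F \<Gamma> \<Sigma>0 y)\<^sup>2 = map_objective \<nu> F \<Gamma> \<Sigma>0 N t x"
proof -
  let ?G = "t ` {0..N}"
  have G: "negligible ?G"
    by (simp add: negligible_finite)
  obtain z where z: "abs_continuous_on_interval 0 T z"
    "\<And>s. s \<in> {0..T} - ?G \<Longrightarrow> (z has_vector_derivative A *v z s + B *v control x s) (at s within {0..T})"
    "\<And>n. n \<le> N \<Longrightarrow> z (t n) = x n"
    by (rule controlled_state[of x]) blast
  obtain y where y: "y \<in> Y_space \<nu> T" "\<And>s m. s \<in> {0..T} \<Longrightarrow> m \<le> \<nu> \<Longrightarrow> D T m y s = transpose (E m) *v z s"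
    "\<And>s. s \<in> {0..T} - ?G \<Longrightarrow> A_op \<nu> T F \<Gamma> y s = control x s"
    by (rule Y_space_of_state[OF z(1) G z(2) square_integrable_control]) blast+
  have states: "states_of \<nu> T N t y x"
    unfolding states_of_def using y(2) z(3) t_range by (simp del: transpose_matrix_vector)
  have "((\<lambda>s. (norm (A_op \<nu> T F \<Gamma> y s - control x s))\<^sup>2) has_integral 0) {0..T}"
    by (rule has_integral_spike[OF G _ has_integral_0]) (simp add: y(3))
  from has_integral_unique[OF this Y_norm_decomposition[OF y(1) states Sigma]]
  have "1/2 * (Y_norm \<nu> T F \<Gamma> \<Sigma>0 y)\<^sup>2 = map_objective \<nu> F \<Gamma> \<Sigma>0 N t x"
    by simp
  with y(1) states show thesis by (rule that)
qed

text \<open>Equality in the decomposition forces the input to be \<open>control x\<close> almost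
  everywhere. Variation of constants from \<open>0\<close> to any \<open>s\<close> then determines
  the state from \<open>x\<close> alone, and extensionality turns agreement on the interval into
  equality.\<close>

lemma optimal_interpolant_unique:
  fixes x :: "nat \<Rightarrow> real^('k \<times> 'd)"
  assumes Sigma: "pos_def_matrix \<Sigma>0"
    and y1: "y1 \<in> Y_space \<nu> T" "states_of \<nu> T N t y1 x"
      "1/2 * (Y_norm \<nu> T F \<Gamma> \<Sigma>0 y1)\<^sup>2 = map_objective \<nu> F \<Gamma> \<Sigma>0 N t x"
    and y2: "y2 \<in> Y_space \<nu> T" "states_of \<nu> T N t y2 x"
      "1/2 * (Y_norm \<nu> T F \<Gamma> \<Sigma>0 y2)\<^sup>2 = map_objective \<nu> F \<Gamma> \<Sigma>0 N t x"
  shows "y1 = y2"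
proof -
  have state: "((\<lambda>r. matrix_exp ((s - r) *\<^sub>R A) *v (B *v control x r)) has_integral
      stacked \<nu> T y s - matrix_exp ((s - 0) *\<^sub>R A) *v x 0) {0..s}"
    if y: "y \<in> Y_space \<nu> T" and states: "states_of \<nu> T N t y x"
      and opt: "1/2 * (Y_norm \<nu> T F \<Gamma> \<Sigma>0 y)\<^sup>2 = map_objective \<nu> F \<Gamma> \<Sigma>0 N t x"
      and s: "s \<in> {0..T}" for y s
  proof -
    have "(Y_norm \<nu> T F \<Gamma> \<Sigma>0 y)\<^sup>2 - 2 * map_objective \<nu> F \<Gamma> \<Sigma>0 N t x = 0"
      using opt by simp
    with Y_norm_decomposition[OF y states Sigma]
    have "((\<lambda>s. (norm (A_op \<nu> T F \<Gamma> y s - control x s))\<^sup>2) has_integral 0) {0..T}"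
      by simp
    then obtain G where G: "negligible G"
      "\<And>s. s \<in> {0..T} - G \<Longrightarrow> (norm (A_op \<nu> T F \<Gamma> y s - control x s))\<^sup>2 = 0"
      by (rule has_integral_0_AE) (simp, blast)
    obtain S where S: "negligible S" "\<And>s. s \<in> {0..T} - S \<Longrightarrow>
        (stacked \<nu> T y has_vector_derivative A *v stacked \<nu> T y s + B *v A_op \<nu> T F \<Gamma> y s) (at s within {0..T})"
      by (rule stacked_state_equation[OF y]) blast
    have "((\<lambda>r. matrix_exp ((s - r) *\<^sub>R A) *v (B *v A_op \<nu> T F \<Gamma> y r)) has_integral
        stacked \<nu> T y s - matrix_exp ((s - 0) *\<^sub>R A) *v stacked \<nu> T y 0) {0..s}"
    proof (rule variation_of_constants[OF _ _ S(1)])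
      show "abs_continuous_on_interval 0 s (stacked \<nu> T y :: real \<Rightarrow> real^('k \<times> 'd))"
        using s by (intro abs_continuous_subinterval[OF abs_continuous_stacked[OF y]]) auto
      fix r assume "r \<in> {0..s} - S"
      then show "(stacked \<nu> T y has_vector_derivative A *v stacked \<nu> T y r + B *v A_op \<nu> T F \<Gamma> y r) (at r within {0..s})"
        using s by (intro has_vector_derivative_within_subset[OF S(2)]) auto
    qed (use s in simp)
    then have "((\<lambda>r. matrix_exp ((s - r) *\<^sub>R A) *v (B *v control x r)) has_integral
        stacked \<nu> T y s - matrix_exp ((s - 0) *\<^sub>R A) *v stacked \<nu> T y 0) {0..s}"
    proof (rule has_integral_spike[OF G(1), rotated])
      fix r assume "r \<in> {0..s} - G"
      then show "matrix_exp ((s - r) *\<^sub>R A) *v (B *v control x r) =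
          matrix_exp ((s - r) *\<^sub>R A) *v (B *v A_op \<nu> T F \<Gamma> y r)"
        using G(2)[of r] s by simp
    qed
    moreover have "x 0 = stacked \<nu> T y 0"
      using states t_0 by (simp add: states_of_iff)
    ultimately show ?thesis by simp
  qed
  show ?thesis
  proof (rule extensionalityI[where A = "{0..T}"])
    fix s assume s: "s \<in> {0..T}"
    have "(stacked \<nu> T y1 s :: real^('k \<times> 'd)) = stacked \<nu> T y2 s"
      using has_integral_unique[OF state[OF y1 s] state[OF y2 s]] by simp
    then show "y1 s = y2 s"
      using transpose_E_stacked[OF card, of 0 T y1 s] transpose_E_stacked[OF card, of 0 T y2 s] by simp
  qed (use y1(1) y2(1) in \<open>auto simp: Y_space_def\<close>)
qed

text \<open>The residual condition at \<open>t 0\<close> follows from the initial conditions, which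
  reconciles the index ranges starting at \<open>0\<close> and at \<open>1\<close>. By
  \<open>1 \<le> \<nu>\<close>, block \<open>1\<close> carries the first derivative.\<close>

lemma interp_feasible_iff:
  assumes "y \<in> Y_space \<nu> T" and states: "states_of \<nu> T N t y (x :: nat \<Rightarrow> real^('k \<times> 'd))" and "1 \<le> \<nu>"
  shows "y \<in> interp_feasible \<nu> T f y0 N t \<longleftrightarrow> map_feasible f y0 N t x"
proof -
  have E0: "transpose (E 0) *v x n = y (t n)" and E1: "transpose (E 1) *v x n = D T 1 y (t n)" if "n \<le> N" for n
    using states that \<open>1 \<le> \<nu>\<close> D.simps(1)[of T y] unfolding states_of_def by (metis le0)+
  have "{0..N} = insert 0 {1..N}" by auto
  then have "(\<forall>s\<in>t ` {0..N}. residual T f y s = 0) \<longleftrightarrow>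
      residual T f y 0 = 0 \<and> (\<forall>n\<in>{1..N}. residual T f y (t n) = 0)"
    by (simp add: t_0)
  then show ?thesis
    using assms(1) E0[of 0] E1[of 0] E0 E1
    unfolding interp_feasible_def map_feasible_def residual_def t_0 by auto
qed

end

theorem proposition3:
  fixes T :: real and \<nu> N :: nat
    and f :: "real \<Rightarrow> real^'d \<Rightarrow> real^'d" and y0 :: "real^'d"
    and t :: "nat \<Rightarrow> real"
    and F :: "nat \<Rightarrow> real^'d^'d" and \<Gamma> :: "real^'d^'d"
    and \<Sigma>0 :: "real^('k::{finite,linorder} \<times> 'd)^('k \<times> 'd)"
  assumes "0 < T"
    and "1 \<le> \<nu>" and "CARD('k) = \<nu> + 1"
    and "t 0 = 0" and "\<And>n. n < N \<Longrightarrow> t n < t (Suc n)" and "t N = T"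
    and "pos_def_matrix \<Gamma>" and "pos_def_matrix \<Sigma>0"
  shows "(\<forall>y x. solves_interp \<nu> T F \<Gamma> \<Sigma>0 f y0 N t y \<longrightarrow> states_of \<nu> T N t y x
            \<longrightarrow> solves_map \<nu> F \<Gamma> \<Sigma>0 f y0 N t x)
       \<and> (\<forall>x. solves_map \<nu> F \<Gamma> \<Sigma>0 f y0 N t x
            \<longrightarrow> (\<exists>!y. min_norm_interpolant \<nu> T F \<Gamma> \<Sigma>0 N t x y)
              \<and> (\<forall>y. min_norm_interpolant \<nu> T F \<Gamma> \<Sigma>0 N t x y
                      \<longrightarrow> solves_interp \<nu> T F \<Gamma> \<Sigma>0 f y0 N t y))"
proof -
  have card: "CARD('k) = Suc \<nu>"
    using assms(3) by simp
  interpret gauss_markov_grid T \<nu> F \<Gamma> "drift \<nu> F :: real^('k \<times> 'd)^('k \<times> 'd)" "E \<nu> ** matrix_sqrt \<Gamma>" N t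
    using card assms by unfold_locales auto
  note Sigma = \<open>pos_def_matrix \<Sigma>0\<close>
  let ?V = "map_objective \<nu> F \<Gamma> \<Sigma>0 N t" and ?J = "\<lambda>y. 1/2 * (Y_norm \<nu> T F \<Gamma> \<Sigma>0 y)\<^sup>2"
  have feasible_Y: "y \<in> Y_space \<nu> T" if "y \<in> interp_feasible \<nu> T f y0 N t" for y
    using that by (simp add: interp_feasible_def)
  have solves_interp_iff: "solves_interp \<nu> T F \<Gamma> \<Sigma>0 f y0 N t y \<longleftrightarrow>
      y \<in> interp_feasible \<nu> T f y0 N t \<and> (\<forall>y'\<in>interp_feasible \<nu> T f y0 N t. ?J y \<le> ?J y')" for y
    unfolding solves_interp_def is_arg_min_linorder by blast
  have solves_map_iff: "solves_map \<nu> F \<Gamma> \<Sigma>0 f y0 N t x \<longleftrightarrow>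
      map_feasible f y0 N t x \<and> (\<forall>x'. map_feasible f y0 N t x' \<longrightarrow> ?V x \<le> ?V x')" for x
    unfolding solves_map_def is_arg_min_linorder by blast
  \<comment> \<open>The lower bound \<open>?V x\<close> is attained by some interpolant, so minimal
    norm means attaining it; one equation replaces the comparison with all interpolants.\<close>
  have min_norm_iff: "min_norm_interpolant \<nu> T F \<Gamma> \<Sigma>0 N t x y \<longleftrightarrow>
      y \<in> Y_space \<nu> T \<and> states_of \<nu> T N t y x \<and> ?J y = ?V x" for x y
  proof -
    obtain y' where y': "y' \<in> Y_space \<nu> T" "states_of \<nu> T N t y' x" "?J y' = ?V x"
      by (rule optimal_interpolant_exists[OF Sigma])
    \<comment> \<open>Minimality is stated for the norm, the decomposition for its square;
      nonnegativity of the norms makes the two comparisons equivalent.\<close>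
    have norm_le: "Y_norm \<nu> T F \<Gamma> \<Sigma>0 u \<le> Y_norm \<nu> T F \<Gamma> \<Sigma>0 w \<longleftrightarrow> ?J u \<le> ?J w"
      if "u \<in> Y_space \<nu> T" "w \<in> Y_space \<nu> T" for u w
      using power_mono_iff[OF Y_norm_nonneg[OF Sigma, of u] Y_norm_nonneg[OF Sigma, of w], of 2] that by simp
    show ?thesis
    proof
      assume "min_norm_interpolant \<nu> T F \<Gamma> \<Sigma>0 N t x y"
      then have y: "y \<in> Y_space \<nu> T" "states_of \<nu> T N t y x" "Y_norm \<nu> T F \<Gamma> \<Sigma>0 y \<le> Y_norm \<nu> T F \<Gamma> \<Sigma>0 y'"
        using y' unfolding min_norm_interpolant_def is_arg_min_linorder by auto
      then show "y \<in> Y_space \<nu> T \<and> states_of \<nu> T N t y x \<and> ?J y = ?V x"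
        using norm_le[OF y(1) y'(1)] y'(3) map_objective_le[OF y(1,2) Sigma] by simp
    next
      assume y: "y \<in> Y_space \<nu> T \<and> states_of \<nu> T N t y x \<and> ?J y = ?V x"
      have "Y_norm \<nu> T F \<Gamma> \<Sigma>0 y \<le> Y_norm \<nu> T F \<Gamma> \<Sigma>0 w" if "w \<in> Y_space \<nu> T" "states_of \<nu> T N t w x" for w
        using norm_le[of y w] map_objective_le[OF that Sigma] y that by simp
      with y show "min_norm_interpolant \<nu> T F \<Gamma> \<Sigma>0 N t x y"
        unfolding min_norm_interpolant_def is_arg_min_linorder by blast
    qed
  qed
  show ?thesis
  proof (intro conjI allI impI)
    fix y and x :: "nat \<Rightarrow> real^('k \<times> 'd)"
    assume interp: "solves_interp \<nu> T F \<Gamma> \<Sigma>0 f y0 N t y" and states: "states_of \<nu> T N t y x"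
    then have y: "y \<in> interp_feasible \<nu> T f y0 N t" "y \<in> Y_space \<nu> T"
      using feasible_Y by (auto simp: solves_interp_iff)
    \<comment> \<open>A feasible \<open>x'\<close> is realised by an interpolant of equal cost,
      which yields the chain \<open>?V x \<le> ?J y \<le> ?J y' = ?V x'\<close>.\<close>
    have "?V x \<le> ?V x'" if x': "map_feasible f y0 N t x'" for x'
    proof -
      obtain y' where y': "y' \<in> Y_space \<nu> T" "states_of \<nu> T N t y' x'" "?J y' = ?V x'"
        by (rule optimal_interpolant_exists[OF Sigma])
      then have "y' \<in> interp_feasible \<nu> T f y0 N t"
        using interp_feasible_iff[OF y'(1,2) \<open>1 \<le> \<nu>\<close>] x' by simp
      then have "?J y \<le> ?J y'"
        using interp by (simp add: solves_interp_iff)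
      then show ?thesis
        using map_objective_le[OF y(2) states Sigma] y'(3) by linarith
    qed
    moreover have "map_feasible f y0 N t x"
      using interp_feasible_iff[OF y(2) states \<open>1 \<le> \<nu>\<close>] y(1) by simp
    ultimately show "solves_map \<nu> F \<Gamma> \<Sigma>0 f y0 N t x"
      by (simp add: solves_map_iff)
  next
    fix x :: "nat \<Rightarrow> real^('k \<times> 'd)"
    obtain y where y: "y \<in> Y_space \<nu> T" "states_of \<nu> T N t y x" "?J y = ?V x"
      by (rule optimal_interpolant_exists[OF Sigma])
    show "\<exists>!y. min_norm_interpolant \<nu> T F \<Gamma> \<Sigma>0 N t x y"
    proof (rule ex1I)
      show "min_norm_interpolant \<nu> T F \<Gamma> \<Sigma>0 N t x y"
        unfolding min_norm_iff using y by simp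
      show "y' = y" if "min_norm_interpolant \<nu> T F \<Gamma> \<Sigma>0 N t x y'" for y'
        using that y unfolding min_norm_iff by (intro optimal_interpolant_unique[OF Sigma]) auto
    qed
  next
    fix x :: "nat \<Rightarrow> real^('k \<times> 'd)" and y
    assume map: "solves_map \<nu> F \<Gamma> \<Sigma>0 f y0 N t x" and "min_norm_interpolant \<nu> T F \<Gamma> \<Sigma>0 N t x y"
    then have y: "y \<in> Y_space \<nu> T" "states_of \<nu> T N t y x" "?J y = ?V x"
      by (auto simp: min_norm_iff)
    \<comment> \<open>Here the competitor \<open>y'\<close> is sampled on the grid, which never
      raises the cost: \<open>?J y = ?V x \<le> ?V x' \<le> ?J y'\<close>.\<close>
    have "?J y \<le> ?J y'" if y': "y' \<in> interp_feasible \<nu> T f y0 N t" for y'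
    proof -
      define x' :: "nat \<Rightarrow> real^('k \<times> 'd)" where "x' n = stacked \<nu> T y' (t n)" for n
      have states: "states_of \<nu> T N t y' x'"
        by (simp add: states_of_iff x'_def)
      then have "map_feasible f y0 N t x'"
        using interp_feasible_iff[OF feasible_Y[OF y'] states \<open>1 \<le> \<nu>\<close>] y' by simp
      then have "?V x \<le> ?V x'"
        using map by (simp add: solves_map_iff)
      then show ?thesis
        using map_objective_le[OF feasible_Y[OF y'] states Sigma] y(3) by linarith
    qed
    moreover have "y \<in> interp_feasible \<nu> T f y0 N t"
      using interp_feasible_iff[OF y(1,2) \<open>1 \<le> \<nu>\<close>] map by (simp add: solves_map_iff)
    ultimately show "solves_interp \<nu> T F \<Gamma> \<Sigma>0 f y0 N t y"
      by (simp add: solves_interp_iff)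
  qed
qed

end
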